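(* Let $(\mathcal{Y}_n)_{n\ge1}$ be the Hollywood process with parameter $(\alpha,\theta,\nu)$, where $\nu$ is a probability distribution on the positive integers, $0<\alpha<1$ and $\theta>-\alpha$. For $n\ge1$ let $p_n(k)=N_k(\mathcal{Y}_n)/v(\mathcal{Y}_n)$, $k\ge1$, be the empirical degree distribution of $\mathcal{Y}_n$. Then for every $k\ge1$, $$p_n(k)\to p_\alpha(k):=\frac{\alpha(1-\alpha)^{\uparrow(k-1)}}{k!}\quad\text{almost surely as }n\to\infty,$$ and $p_\alpha(k)\sim \alpha k^{-(\alpha+1)}/\Gamma(1-\alpha)$ as $k\to\infty$. That is, $(\mathcal{Y}_n)$ has a power law degree distribution with exponent $\gamma=1+\alpha\in(1,2)$.
   Context: Hollywood process with parameter $(\alpha,\theta,\nu)$: generate $X_1,X_2,\dots$ as follows. For each $n$, independently draw $K_n\sim\nu$; given $K_n=k$ choose $X_{n,1},\dots,X_{n,k}$ sequentially. Let $V_n(j)$ be the number of distinct labels among $X_1,\dots,X_{n-1},X_{n,1},\dots,X_{n,j-1}$ (labels $1,2,\dots$ assigned in order of first appearance), and for $i\le V_n(j)$ let $D_{n,j}(i)$ be the number of occurrences of label $i$ among these. Then $\mathrm{pr}(X_{n,j}=i\mid\text{past})\propto D_{n,j}(i)-\alpha$ for $i=1,\dots,V_n(j)$ and $\propto\theta+\alpha V_n(j)$ for $i=V_n(j)+1$. Set $X_n=(X_{n,1},\dots,X_{n,K_n})$ and let $\mathcal{Y}_n$ be the edge-labeled network (vertex labels forgotten, edge labels $1,\dots,n$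 kept) with edges $X_1,\dots,X_n$. For such a network, $v(\mathcal{Y}_n)$ is the number of distinct vertices appearing in its edges and $N_k(\mathcal{Y}_n)$ is the number of vertices whose total number of appearances (counted with multiplicity over all edges) equals $k$. $x^{\uparrow j}=x(x+1)\cdots(x+j-1)$ and $\Gamma$ is the gamma function. A sequence has a power law degree distribution with exponent $\gamma>1$ if its degree proportions satisfy $d_k\sim\ell(k)k^{-\gamma}$ for large $k$ with $\ell$ slowly varying. *)

theory Defs
  imports "HOL-Probability.Probability" "HOL-Library.Landau_Symbols"
begin

text \<open>Conditional probability that the next vertex label equals i, given the list
  past of all labels drawn so far (Pitman--Yor / Chinese restaurant rule).
  V = number of distinct labels so far (labels are 1..V in order of first appearance),
  D(i) = count_list past i.  With an empty past the first label is 1 with probability 1.\<close>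
definition crp_prob :: "real \<Rightarrow> real \<Rightarrow> nat list \<Rightarrow> nat \<Rightarrow> real" where
  "crp_prob \<alpha> \<theta> past i =
     (let m = length past; V = card (set past) in
      if past = [] then (if i = 1 then 1 else 0)
      else if 1 \<le> i \<and> i \<le> V then (real (count_list past i) - \<alpha>) / (real m + \<theta>)
      else if i = V + 1 then (\<theta> + \<alpha> * real V) / (real m + \<theta>)
      else 0)"

definition hw_next_prob :: "real \<Rightarrow> real \<Rightarrow> nat pmf \<Rightarrow> nat list list \<Rightarrow> nat list \<Rightarrow> real" where
  "hw_next_prob \<alpha> \<theta> \<nu> hist e =
     pmf \<nu> (length e) * (\<Prod>j<length e. crp_prob \<alpha> \<theta> (concat hist @ take j e) (e ! j))"

definition hollywood_process ::
  "'a measure \<Rightarrow> real \<Rightarrow> real \<Rightarrow> nat pmf \<Rightarrow> (nat \<Rightarrow> 'a \<Rightarrow> nat list) \<Rightarrow> bool" where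
  "hollywood_process M \<alpha> \<theta> \<nu> X \<longleftrightarrow>
     prob_space M \<and>
     (\<forall>n\<ge>1. X n \<in> measurable M (count_space UNIV)) \<and>
     (\<forall>n xs. length xs = n \<longrightarrow>
        measure M {\<omega> \<in> space M. map (\<lambda>i. X i \<omega>) [1..<n+1] = xs}
          = (\<Prod>i<n. hw_next_prob \<alpha> \<theta> \<nu> (take i xs) (xs ! i)))"

text \<open>The network Y_n is represented by its list of edges [X_1,...,X_n]
  (edge labels = list positions); v and N_k do not depend on vertex labels.\<close>
definition net_v :: "nat list list \<Rightarrow> nat" where
  "net_v es = card (set (concat es))"

definition net_N :: "nat \<Rightarrow> nat list list \<Rightarrow> nat" where
  "net_N k es = card {x \<in> set (concat es). count_list (concat es) x = k}"

definition hw_network :: "(nat \<Rightarrow> 'a \<Rightarrow> nat list) \<Rightarrow> nat \<Rightarrow> 'a \<Rightarrow> nat list list" where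
  "hw_network X n \<omega> = map (\<lambda>i. X i \<omega>) [1..<n+1]"

definition p_alpha :: "real \<Rightarrow> nat \<Rightarrow> real" where
  "p_alpha \<alpha> k = \<alpha> * pochhammer (1 - \<alpha>) (k - 1) / fact k"

definition slowly_varying :: "(real \<Rightarrow> real) \<Rightarrow> bool" where
  "slowly_varying L \<longleftrightarrow> (\<forall>c>0. ((\<lambda>x. L (c * x) / L x) \<longlongrightarrow> 1) at_top)"

definition power_law :: "(nat \<Rightarrow> real) \<Rightarrow> real \<Rightarrow> bool" where
  "power_law d \<gamma> \<longleftrightarrow> \<gamma> > 1 \<and>
     (\<exists>L. slowly_varying L \<and> d \<sim>[at_top] (\<lambda>k. L (real k) * real k powr (- \<gamma>)))"

end

theory Submission
  imports Defs "HOL-Real_Asymp.Real_Asymp"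
begin

text \<open>
  Reading the vertices of all edges one after another gives a Chinese restaurant process with
  parameter \<open>(\<alpha>, \<theta>)\<close> whose law does not depend on \<open>\<nu>\<close>, and the networks observe it along a
  sequence of times tending to infinity. So it suffices to study that process.

  Let \<open>W\<^sub>k\<close> be the number of vertices of degree at least \<open>k\<close>, put \<open>V = W\<^sub>1 + \<theta>/\<alpha>\<close> and
  \<open>w\<^sub>k = (1-\<alpha>)(2-\<alpha>)\<cdots>(k-1-\<alpha>)/(k-1)!\<close>. At time \<open>m\<close> the drift of \<open>V\<close> is \<open>\<alpha> V / (m+\<theta>)\<close>, so \<open>V\<close>
  divided by a deterministic sequence \<open>c\<^sub>m\<close> of order \<open>m\<^sup>\<alpha>\<close> is a martingale bounded in \<open>L\<^sup>2\<close>. The drift of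
  \<open>U\<^sub>k\<^sub>+\<^sub>1 = W\<^sub>k\<^sub>+\<^sub>1 - w\<^sub>k\<^sub>+\<^sub>1 V\<close> is \<open>(k-\<alpha>)(U\<^sub>k - U\<^sub>k\<^sub>+\<^sub>1)/(m+\<theta>)\<close>, a contraction, which gives
  \<open>E U\<^sub>k\<^sup>2 = O(c\<^sub>m)\<close> by induction on \<open>k\<close>. Along the times \<open>(i+1)\<^sup>p\<close> with \<open>p \<alpha> \<ge> 4\<close> these second moment
  bounds are summable, hence almost surely \<open>U\<^sub>k / c \<rightarrow> 0\<close> and \<open>V / c \<rightarrow> S\<close>. A negative moment of \<open>V\<close>, which
  can be computed exactly, shows \<open>S > 0\<close> by Fatou's lemma. Hence \<open>W\<^sub>k / W\<^sub>1 \<rightarrow> w\<^sub>k\<close> along these times,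
  and by monotonicity of \<open>W\<^sub>k\<close> along all times.
\<close>

section \<open>Asymptotics of Pochhammer quotients\<close>

text \<open>Divide the products \<open>Gamma_series'\<close> for \<open>b\<close> and
  \<open>a\<close>: each converges to its Gamma value, and the factorials cancel in the
  quotient.\<close>

lemma pochhammer_ratio_tendsto:
  fixes a b :: real
  assumes "0 < a" "0 < b"
  shows "(\<lambda>n. pochhammer a n / pochhammer b n * real n powr (b - a)) \<longlonglongrightarrow> Gamma b / Gamma a"
proof -
  have "(\<lambda>n. Gamma_series' b n / Gamma_series' a n) \<longlonglongrightarrow> Gamma b / Gamma a"
    using assms by (intro tendsto_divide Gamma_series'_LIMSEQ) (auto simp: Gamma_eq_zero_iff)
  moreover have "eventually (\<lambda>n. Gamma_series' b n / Gamma_series' a n =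
      pochhammer a n / pochhammer b n * real n powr (b - a)) sequentially"
    using eventually_gt_at_top[of 0]
  proof eventually_elim
    case (elim n)
    have "exp (b * ln (real n)) / exp (a * ln (real n)) = real n powr (b - a)"
      using elim by (simp add: powr_def exp_diff algebra_simps)
    then have "exp (b * ln (real n)) = real n powr (b - a) * exp (a * ln (real n))"
      by (simp add: field_simps)
    then show ?case by (simp add: Gamma_series'_def)
  qed
  ultimately show ?thesis by (rule Lim_transform_eventually)
qed

text \<open>With base \<open>Suc n\<close> the power is positive at \<open>n = 0\<close> too, so
  that bounds can hold for every \<open>n\<close>.\<close>

lemma pochhammer_ratio_tendsto_Suc:
  fixes a b :: real
  assumes "0 < a" "0 < b"
  shows "(\<lambda>n. pochhammer a n / pochhammer b n * real (Suc n) powr (b - a)) \<longlonglongrightarrow> Gamma b / Gamma a"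
    (is "?f \<longlonglongrightarrow> _")
proof -
  have "(\<lambda>n. (real (Suc n) / real n) powr (b - a)) \<longlonglongrightarrow> 1" by real_asymp
  from tendsto_mult[OF pochhammer_ratio_tendsto[OF assms] this]
  have "(\<lambda>n. pochhammer a n / pochhammer b n * real n powr (b - a) * (real (Suc n) / real n) powr (b - a))
      \<longlonglongrightarrow> Gamma b / Gamma a" by simp
  moreover have "eventually (\<lambda>n. pochhammer a n / pochhammer b n * real n powr (b - a) *
      (real (Suc n) / real n) powr (b - a) = ?f n) sequentially"
    using eventually_gt_at_top[of 0]
    by eventually_elim (simp add: powr_divide)
  ultimately show ?thesis by (rule Lim_transform_eventually)
qed

text \<open>A positive sequence with a positive limit is bounded, and so is its inverse.\<close>

lemma pochhammer_ratio_bounds: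
  fixes a b :: real
  assumes "0 < a" "0 < b"
  obtains L U where "0 < L" "0 < U"
    "\<And>n. L * real (Suc n) powr (a - b) \<le> pochhammer a n / pochhammer b n"
    "\<And>n. pochhammer a n / pochhammer b n \<le> U * real (Suc n) powr (a - b)"
proof -
  define f where "f n = pochhammer a n / pochhammer b n * real (Suc n) powr (b - a)" for n
  have pos: "0 < f n" for n using assms by (simp add: f_def pochhammer_pos)
  have lim: "f \<longlonglongrightarrow> Gamma b / Gamma a"
    using pochhammer_ratio_tendsto_Suc[OF assms] by (simp add: f_def[abs_def])
  have G: "0 < Gamma b / Gamma a" using assms by (simp add: Gamma_real_pos)
  obtain U where U: "0 < U" "\<And>n. norm (f n) \<le> U"
    using convergent_imp_Bseq[OF convergentI[OF lim]] by (auto simp: Bseq_def)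
  have "(\<lambda>n. inverse (f n)) \<longlonglongrightarrow> inverse (Gamma b / Gamma a)"
    using lim G by (intro tendsto_inverse) auto
  from convergent_imp_Bseq[OF convergentI[OF this]]
  obtain K where K: "0 < K" "\<And>n. norm (inverse (f n)) \<le> K"
    unfolding Bseq_def by blast
  have ratio: "pochhammer a n / pochhammer b n = f n * real (Suc n) powr (a - b)" for n
    by (simp add: f_def powr_diff)
  show ?thesis
  proof (rule that[of "1 / K" U])
    fix n
    have "1 / K \<le> f n" using K(2)[of n] K(1) pos[of n] by (simp add: field_simps)
    then show "1 / K * real (Suc n) powr (a - b) \<le> pochhammer a n / pochhammer b n"
      unfolding ratio by (intro mult_right_mono) auto
    show "pochhammer a n / pochhammer b n \<le> U * real (Suc n) powr (a - b)"
      unfolding ratio using U(2)[of n] by (intro mult_right_mono) auto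
  qed (use U(1) K(1) in auto)
qed

text \<open>Splitting a factor \<open>k\<close> off \<open>fact k\<close> leaves the Pochhammer
  quotient for \<open>a = 1 - \<alpha>\<close>, \<open>b = 1\<close> at \<open>k - 1\<close>.
  Passing from base \<open>k - 1\<close> to base \<open>k\<close> costs a factor tending to
  1.\<close>

lemma p_alpha_asymp:
  assumes "0 < \<alpha>" "\<alpha> < 1"
  shows "p_alpha \<alpha> \<sim>[at_top] (\<lambda>k. \<alpha> * real k powr (- (\<alpha> + 1)) / Gamma (1 - \<alpha>))"
proof (rule asymp_equivI')
  let ?R = "\<lambda>n. pochhammer (1 - \<alpha>) n / pochhammer 1 n * real n powr \<alpha>"
  have lim: "(\<lambda>k. ?R (k - 1)) \<longlonglongrightarrow> 1 / Gamma (1 - \<alpha>)"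
    using pochhammer_ratio_tendsto[of "1 - \<alpha>" 1] assms
    by (intro filterlim_compose[OF _ filterlim_minus_const_nat_at_top]) auto
  have lim2: "(\<lambda>k. (real k / real (k - 1)) powr \<alpha>) \<longlonglongrightarrow> 1"
  proof -
    have "(\<lambda>k. (real k / (real k - 1)) powr \<alpha>) \<longlonglongrightarrow> 1" by real_asymp
    then show ?thesis
      by (rule Lim_transform_eventually)
        (use eventually_gt_at_top[of 0] in eventually_elim, simp add: of_nat_diff)
  qed
  have G: "0 < Gamma (1 - \<alpha>)" using assms by (simp add: Gamma_real_pos)
  have "(\<lambda>k. ?R (k - 1) * (real k / real (k - 1)) powr \<alpha> * Gamma (1 - \<alpha>)) \<longlonglongrightarrow>
      1 / Gamma (1 - \<alpha>) * 1 * Gamma (1 - \<alpha>)"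
    by (intro tendsto_mult lim lim2 tendsto_const)
  then have "(\<lambda>k. ?R (k - 1) * (real k / real (k - 1)) powr \<alpha> * Gamma (1 - \<alpha>)) \<longlonglongrightarrow> 1"
    using G by simp
  moreover have "eventually (\<lambda>k. ?R (k - 1) * (real k / real (k - 1)) powr \<alpha> * Gamma (1 - \<alpha>) =
      p_alpha \<alpha> k / (\<alpha> * real k powr (- (\<alpha> + 1)) / Gamma (1 - \<alpha>))) sequentially"
    using eventually_gt_at_top[of 1]
  proof eventually_elim
    case (elim k)
    then obtain m where k: "k = Suc m" "0 < m" by (cases k) auto
    have "real k powr (- (\<alpha> + 1)) = 1 / (real k powr \<alpha> * real k)"
    proof -
      have "real k powr (- (\<alpha> + 1)) = inverse (real k powr (\<alpha> + 1))" by (rule powr_minus)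
      then show ?thesis using k by (simp add: powr_add inverse_eq_divide)
    qed
    then show ?case using assms k
      by (simp add: p_alpha_def pochhammer_fact[symmetric] powr_divide field_simps del: of_nat_Suc)
  qed
  ultimately show "(\<lambda>k. p_alpha \<alpha> k / (\<alpha> * real k powr (- (\<alpha> + 1)) / Gamma (1 - \<alpha>))) \<longlonglongrightarrow> 1"
    by (rule Lim_transform_eventually)
qed

text \<open>The slowly varying factor can be taken constant.\<close>

lemma p_alpha_power_law:
  assumes "0 < \<alpha>" "\<alpha> < 1"
  shows "power_law (p_alpha \<alpha>) (1 + \<alpha>)"
proof -
  have "0 < Gamma (1 - \<alpha>)" using assms by (simp add: Gamma_real_pos)
  then have "\<alpha> / Gamma (1 - \<alpha>) \<noteq> 0" using assms(1) by simp
  then have "slowly_varying (\<lambda>x. \<alpha> / Gamma (1 - \<alpha>))"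
    unfolding slowly_varying_def by (simp only: divide_self tendsto_const simp_thms)
  moreover have "p_alpha \<alpha> \<sim>[at_top] (\<lambda>k. \<alpha> / Gamma (1 - \<alpha>) * real k powr (- (1 + \<alpha>)))"
    using p_alpha_asymp[OF assms] by (simp add: add.commute)
  ultimately show ?thesis using assms(1) unfolding power_law_def
    by (intro conjI exI[of _ "\<lambda>x. \<alpha> / Gamma (1 - \<alpha>)"]) auto
qed

section \<open>Chinese restaurant process and law of the network\<close>

text \<open>Applied where the outcome determines the intermediate value: an extended list determines
  its prefix, an edge determines its size.\<close>

lemma pmf_bind_single:
  assumes "\<And>x. x \<in> set_pmf N \<Longrightarrow> x \<noteq> a \<Longrightarrow> pmf (f x) y = 0"
  shows "pmf (bind_pmf N f) y = pmf N a * pmf (f a) y"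
proof -
  have "pmf (bind_pmf N f) y = measure_pmf.expectation N (\<lambda>x. pmf (f x) y)"
    by (simp add: pmf_bind)
  also have "\<dots> = (\<Sum>x\<in>{a}. pmf (f x) y * pmf N x)"
    by (rule integral_measure_pmf_real) (use assms in auto)
  finally show ?thesis by simp
qed

lemma card_set_ge_1: "l \<noteq> [] \<Longrightarrow> 1 \<le> card (set l)"
  by (simp add: Suc_le_eq card_gt_0_iff)

locale crp =
  fixes \<alpha> \<theta> :: real
  assumes \<alpha>_pos: "0 < \<alpha>" and \<alpha>_less_1: "\<alpha> < 1" and \<theta>_gt: "- \<alpha> < \<theta>"
begin

text \<open>What labelling in order of first appearance leaves behind: the labels in use form an
  initial segment. This suffices for \<open>crp_prob\<close> to be a probability
  distribution.\<close>

definition valid :: "nat list \<Rightarrow> bool" where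
  "valid l \<longleftrightarrow> (\<exists>v. set l = {1..v})"

lemma valid_set: "valid l \<Longrightarrow> {1..card (set l)} = set l"
  unfolding valid_def by (metis card_atLeastAtMost diff_Suc_1)

lemma valid_iff: "valid l \<Longrightarrow> i \<in> set l \<longleftrightarrow> 1 \<le> i \<and> i \<le> card (set l)"
  by (metis valid_set atLeastAtMost_iff)

lemma valid_Nil: "valid []"
  unfolding valid_def by (intro exI[of _ 0]) simp

lemma length_\<theta>_pos: "l \<noteq> [] \<Longrightarrow> 0 < real (length l) + \<theta>"
  using \<alpha>_less_1 \<theta>_gt by (cases l) auto

lemma \<theta>_distinct_pos: "l \<noteq> [] \<Longrightarrow> 0 < \<theta> + \<alpha> * real (card (set l))"
proof -
  assume "l \<noteq> []"
  then have "1 \<le> card (set l)" by (rule card_set_ge_1)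
  then have "\<alpha> * 1 \<le> \<alpha> * real (card (set l))" using \<alpha>_pos by (intro mult_left_mono) auto
  with \<theta>_gt show ?thesis by simp
qed

text \<open>A label in use has count at least 1 > \<alpha>. A nonempty history has at least one
  label, so \<theta> > -\<alpha> makes the weight of a new label positive.\<close>

lemma crp_prob_nonneg:
  assumes "valid l"
  shows "0 \<le> crp_prob \<alpha> \<theta> l i"
proof (cases "l = []")
  case False
  have "1 \<le> count_list l i" if "1 \<le> i" "i \<le> card (set l)"
  proof -
    have "i \<in> set l" using assms that by (simp add: valid_iff)
    then show ?thesis by (metis One_nat_def Suc_leI count_list_0_iff not_gr_zero)
  qed
  then have "0 \<le> real (count_list l i) - \<alpha>" if "1 \<le> i" "i \<le> card (set l)"
    using that \<alpha>_less_1 by fastforce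
  then show ?thesis
    using length_\<theta>_pos[OF False] \<theta>_distinct_pos[OF False] False by (auto simp: crp_prob_def Let_def)
qed (auto simp: crp_prob_def)

lemma sum_crp_prob_weighted:
  assumes "valid l" "l \<noteq> []"
  shows "(\<Sum>i\<in>{1..Suc (card (set l))}. f i * crp_prob \<alpha> \<theta> l i) =
    ((\<Sum>i\<in>set l. f i * (real (count_list l i) - \<alpha>)) +
      f (Suc (card (set l))) * (\<theta> + \<alpha> * real (card (set l)))) / (real (length l) + \<theta>)"
proof -
  have "(\<Sum>i\<in>{1..card (set l)}. f i * crp_prob \<alpha> \<theta> l i) =
      (\<Sum>i\<in>set l. f i * (real (count_list l i) - \<alpha>)) / (real (length l) + \<theta>)"
    unfolding sum_divide_distrib
  proof (rule sum.cong)
    show "{1..card (set l)} = set l" by (rule valid_set[OF assms(1)])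
  next
    fix i assume "i \<in> set l"
    then have "i \<in> {1..card (set l)}" by (simp only: valid_set[OF assms(1)])
    then show "f i * crp_prob \<alpha> \<theta> l i =
        f i * (real (count_list l i) - \<alpha>) / (real (length l) + \<theta>)"
      using assms(2) by (simp add: crp_prob_def)
  qed
  moreover have "crp_prob \<alpha> \<theta> l (Suc (card (set l))) =
      (\<theta> + \<alpha> * real (card (set l))) / (real (length l) + \<theta>)"
    using assms(2) by (simp add: crp_prob_def)
  ultimately show ?thesis by (simp add: add_divide_distrib[of "sum _ _"])
qed

lemma crp_prob_eq_0: "i \<notin> {1..Suc (card (set l))} \<Longrightarrow> crp_prob \<alpha> \<theta> l i = 0"
  by (auto simp: crp_prob_def Let_def)

lemma sum_crp_prob:
  assumes "valid l"
  shows "(\<Sum>i\<in>{1..Suc (card (set l))}. crp_prob \<alpha> \<theta> l i) = 1"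
proof (cases "l = []")
  case False
  have "(\<Sum>i\<in>set l. real (count_list l i)) = real (length l)"
    by (metis of_nat_sum sum_count_set List.finite_set order_refl)
  then show ?thesis
    using sum_crp_prob_weighted[OF assms False, of "\<lambda>_. 1"] length_\<theta>_pos[OF False]
    by (simp add: sum_subtractf)
qed (simp add: crp_prob_def)

section \<open>Sampling labels one by one\<close>

definition crp_step :: "nat list \<Rightarrow> nat pmf" where
  "crp_step l = embed_pmf (crp_prob \<alpha> \<theta> l)"

lemma pmf_crp_step:
  assumes "valid l"
  shows "pmf (crp_step l) i = crp_prob \<alpha> \<theta> l i"
  unfolding crp_step_def
proof (rule pmf_embed_pmf)
  show "0 \<le> crp_prob \<alpha> \<theta> l j" for j by (rule crp_prob_nonneg[OF assms])
  have "(\<integral>\<^sup>+ i. ennreal (crp_prob \<alpha> \<theta> l i) \<partial>count_space UNIV) =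
      (\<Sum>i\<in>{1..Suc (card (set l))}. ennreal (crp_prob \<alpha> \<theta> l i))"
    by (rule nn_integral_count_space') (auto simp: crp_prob_eq_0)
  also have "\<dots> = 1"
    by (subst sum_ennreal) (simp_all only: crp_prob_nonneg[OF assms] sum_crp_prob[OF assms] ennreal_1)
  finally show "(\<integral>\<^sup>+ i. ennreal (crp_prob \<alpha> \<theta> l i) \<partial>count_space UNIV) = 1" .
qed

lemma set_crp_step: "valid l \<Longrightarrow> set_pmf (crp_step l) \<subseteq> {1..Suc (card (set l))}"
proof
  fix i assume "valid l" "i \<in> set_pmf (crp_step l)"
  then have "crp_prob \<alpha> \<theta> l i \<noteq> 0" by (simp add: set_pmf_iff pmf_crp_step)
  then show "i \<in> {1..Suc (card (set l))}" using crp_prob_eq_0 by blast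
qed

lemma valid_append1: "valid l \<Longrightarrow> i \<in> set_pmf (crp_step l) \<Longrightarrow> valid (l @ [i])"
proof -
  assume v: "valid l" and i: "i \<in> set_pmf (crp_step l)"
  have "i \<in> {1..Suc (card (set l))}" using set_crp_step[OF v] i by auto
  then consider "i \<in> set l" | "i = Suc (card (set l))"
    using valid_iff[OF v] by fastforce
  then show "valid (l @ [i])"
  proof cases
    case 1
    then show ?thesis using v by (simp add: valid_def insert_absorb)
  next
    case 2
    then have "set (l @ [i]) = {1..Suc (card (set l))}"
      using arg_cong[OF valid_set[OF v], of "insert i"] by (simp add: atLeastAtMostSuc_conv)
    then show ?thesis unfolding valid_def by (rule exI)
  qed
qed

lemma expectation_crp_step:
  assumes "valid l" "l \<noteq> []"
  shows "measure_pmf.expectation (crp_step l) f =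
    ((\<Sum>i\<in>set l. f i * (real (count_list l i) - \<alpha>)) +
      f (Suc (card (set l))) * (\<theta> + \<alpha> * real (card (set l)))) / (real (length l) + \<theta>)"
proof -
  have "measure_pmf.expectation (crp_step l) f =
      (\<Sum>i\<in>{1..Suc (card (set l))}. f i * pmf (crp_step l) i)"
    by (rule integral_measure_pmf_real) (use set_crp_step[OF assms(1)] in auto)
  then show ?thesis
    using sum_crp_prob_weighted[OF assms] by (simp only: pmf_crp_step[OF assms(1)])
qed

text \<open>Law of the next labels given the past \<open>l\<close>. Only the new labels are
  returned, so that they can form an edge.\<close>

primrec crp_ext :: "nat list \<Rightarrow> nat \<Rightarrow> nat list pmf" where
  "crp_ext l 0 = return_pmf []"
| "crp_ext l (Suc k) = bind_pmf (crp_ext l k) (\<lambda>e. map_pmf (\<lambda>i. e @ [i]) (crp_step (l @ e)))"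

lemma length_crp_ext: "e \<in> set_pmf (crp_ext l k) \<Longrightarrow> length e = k"
  by (induction k arbitrary: e) auto

lemma valid_crp_ext: "valid l \<Longrightarrow> e \<in> set_pmf (crp_ext l k) \<Longrightarrow> valid (l @ e)"
proof (induction k arbitrary: e)
  case (Suc k)
  then show ?case using valid_append1 by fastforce
qed simp

text \<open>Chapman-Kolmogorov equation: the past enters only through the list
  \<open>l @ e\<close>.\<close>

lemma crp_ext_add:
  "crp_ext l (j + k) = bind_pmf (crp_ext l j) (\<lambda>e. map_pmf ((@) e) (crp_ext (l @ e) k))"
  by (induction k)
    (simp_all add: bind_assoc_pmf map_pmf_def bind_return_pmf bind_return_pmf')

text \<open>Consistency: later draws do not change the law of the earlier ones.\<close>

lemma map_take_crp_ext:
  assumes "m \<le> t"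
  shows "map_pmf (take m) (crp_ext l t) = crp_ext l m"
proof -
  obtain k where t: "t = m + k" using assms le_Suc_ex by blast
  have "map_pmf (take m) (crp_ext l t) =
      bind_pmf (crp_ext l m) (\<lambda>e. map_pmf (\<lambda>e'. take m (e @ e')) (crp_ext (l @ e) k))"
    by (simp add: t crp_ext_add map_bind_pmf pmf.map_comp o_def)
  also have "\<dots> = bind_pmf (crp_ext l m) return_pmf"
    by (rule bind_pmf_cong) (auto dest: length_crp_ext simp: map_pmf_const)
  finally show ?thesis by (simp add: bind_return_pmf')
qed

lemma pmf_crp_ext:
  assumes "valid l"
  shows "pmf (crp_ext l (length e)) e = (\<Prod>j<length e. crp_prob \<alpha> \<theta> (l @ take j e) (e ! j))"
proof (induction e rule: rev_induct)
  case (snoc i e)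
  have "pmf (crp_ext l (length (e @ [i]))) (e @ [i]) =
      pmf (crp_ext l (length e)) e * pmf (map_pmf (\<lambda>i. e @ [i]) (crp_step (l @ e))) (e @ [i])"
    by (simp, rule pmf_bind_single) (auto simp: pmf_eq_0_set_pmf)
  also have "pmf (map_pmf (\<lambda>i. e @ [i]) (crp_step (l @ e))) (e @ [i]) = pmf (crp_step (l @ e)) i"
    by (rule pmf_map_inj') (auto intro: injI)
  \<comment> \<open>If \<open>e\<close> has probability zero, both sides vanish; otherwise
    \<open>l @ e\<close> is valid and the step law is \<open>crp_prob\<close>.\<close>
  also have "pmf (crp_ext l (length e)) e * pmf (crp_step (l @ e)) i =
      pmf (crp_ext l (length e)) e * crp_prob \<alpha> \<theta> (l @ e) i"
    using pmf_crp_step[OF valid_crp_ext[OF assms]] by (cases "e \<in> set_pmf (crp_ext l (length e))")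
      (auto simp: pmf_eq_0_set_pmf)
  finally show ?case by (simp add: snoc nth_append)
qed simp

section \<open>Law of the list of edges and of its concatenation\<close>

primrec hw_pmf :: "nat pmf \<Rightarrow> nat \<Rightarrow> nat list list pmf" where
  "hw_pmf \<nu> 0 = return_pmf []"
| "hw_pmf \<nu> (Suc n) = bind_pmf (hw_pmf \<nu> n) (\<lambda>h. bind_pmf \<nu> (\<lambda>k.
     map_pmf (\<lambda>e. h @ [e]) (crp_ext (concat h) k)))"

lemma hw_pmf_props:
  "h \<in> set_pmf (hw_pmf \<nu> n) \<Longrightarrow>
     length h = n \<and> valid (concat h) \<and> (\<forall>e\<in>set h. length e \<in> set_pmf \<nu>)"
proof (induction n arbitrary: h)
  case (Suc n)
  then show ?case by (auto dest: length_crp_ext intro!: valid_crp_ext)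
qed (simp add: valid_Nil)

text \<open>Identifies \<open>hw_pmf\<close> with the finite-dimensional laws prescribed in
  \<open>hollywood_process\<close>.\<close>

lemma pmf_hw_pmf:
  "pmf (hw_pmf \<nu> (length xs)) xs = (\<Prod>i<length xs. hw_next_prob \<alpha> \<theta> \<nu> (take i xs) (xs ! i))"
proof (induction xs rule: rev_induct)
  case (snoc e h)
  let ?E = "\<lambda>k. map_pmf (\<lambda>e. h @ [e]) (crp_ext (concat h) k)"
  have "pmf (hw_pmf \<nu> (length (h @ [e]))) (h @ [e]) =
      pmf (hw_pmf \<nu> (length h)) h * pmf (bind_pmf \<nu> ?E) (h @ [e])"
    by (simp, rule pmf_bind_single) (auto simp: pmf_eq_0_set_pmf)
  also have "pmf (bind_pmf \<nu> ?E) (h @ [e]) = pmf \<nu> (length e) * pmf (?E (length e)) (h @ [e])"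
    by (rule pmf_bind_single) (auto simp: pmf_eq_0_set_pmf dest: length_crp_ext)
  also have "pmf (?E (length e)) (h @ [e]) = pmf (crp_ext (concat h) (length e)) e"
    by (rule pmf_map_inj') (auto intro: injI)
  also have "pmf (hw_pmf \<nu> (length h)) h * (pmf \<nu> (length e) * \<dots>) =
      pmf (hw_pmf \<nu> (length h)) h * hw_next_prob \<alpha> \<theta> \<nu> h e"
  proof (cases "h \<in> set_pmf (hw_pmf \<nu> (length h))")
    case True
    then have "valid (concat h)" using hw_pmf_props by blast
    then show ?thesis by (simp add: hw_next_prob_def pmf_crp_ext)
  qed (simp add: pmf_eq_0_set_pmf)
  finally show ?case by (simp add: snoc nth_append)
qed simp

text \<open>Law of the total number of vertex slots in the first \<open>n\<close> edges.\<close>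

primrec total_pmf :: "nat pmf \<Rightarrow> nat \<Rightarrow> nat pmf" where
  "total_pmf \<nu> 0 = return_pmf 0"
| "total_pmf \<nu> (Suc n) = bind_pmf (total_pmf \<nu> n) (\<lambda>t. map_pmf ((+) t) \<nu>)"

lemma total_pmf_ge:
  assumes "0 \<notin> set_pmf \<nu>"
  shows "t \<in> set_pmf (total_pmf \<nu> n) \<Longrightarrow> n \<le> t"
proof (induction n arbitrary: t)
  case (Suc n)
  then obtain u k where "t = u + k" "n \<le> u" "k \<in> set_pmf \<nu>" by auto
  then show ?case using assms by (cases k) auto
qed simp

text \<open>Edge sizes are independent of the labels, so all sizes may be drawn first and the labels
  afterwards in a single run.\<close>

lemma map_concat_hw_pmf:
  "map_pmf concat (hw_pmf \<nu> n) = bind_pmf (total_pmf \<nu> n) (crp_ext [])"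
proof (induction n)
  case 0
  show ?case by (simp add: bind_return_pmf)
next
  case (Suc n)
  have "map_pmf concat (hw_pmf \<nu> (Suc n)) =
      bind_pmf (map_pmf concat (hw_pmf \<nu> n)) (\<lambda>l. bind_pmf \<nu> (\<lambda>k. map_pmf ((@) l) (crp_ext l k)))"
    by (simp add: map_bind_pmf bind_map_pmf pmf.map_comp o_def)
  also have "\<dots> = bind_pmf (total_pmf \<nu> n) (\<lambda>t. bind_pmf (crp_ext [] t) (\<lambda>l.
      bind_pmf \<nu> (\<lambda>k. map_pmf ((@) l) (crp_ext l k))))"
    by (simp add: Suc bind_assoc_pmf)
  \<comment> \<open>The size of the new edge is drawn before the earlier labels;
    \<open>crp_ext_add\<close> then merges the two runs of labels.\<close>
  also have "\<dots> = bind_pmf (total_pmf \<nu> n) (\<lambda>t. bind_pmf \<nu> (\<lambda>k.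
      bind_pmf (crp_ext [] t) (\<lambda>l. map_pmf ((@) l) (crp_ext l k))))"
    by (subst (2) bind_commute_pmf) simp
  also have "\<dots> = bind_pmf (total_pmf \<nu> (Suc n)) (crp_ext [])"
    by (simp add: bind_assoc_pmf bind_map_pmf crp_ext_add)
  finally show ?case .
qed

text \<open>Here \<nu> disappears: with nonempty edges, \<open>n\<close> edges carry at least
  \<open>m\<close> labels, and truncating a longer run to \<open>m\<close> labels gives the law of
  the run of length \<open>m\<close>.\<close>

lemma map_take_concat_hw_pmf:
  assumes "0 \<notin> set_pmf \<nu>" "m \<le> n"
  shows "map_pmf (\<lambda>h. take m (concat h)) (hw_pmf \<nu> n) = crp_ext [] m"
proof -
  have "map_pmf (\<lambda>h. take m (concat h)) (hw_pmf \<nu> n) =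
      map_pmf (take m) (map_pmf concat (hw_pmf \<nu> n))"
    by (simp add: pmf.map_comp o_def)
  also have "\<dots> = bind_pmf (total_pmf \<nu> n) (\<lambda>t. map_pmf (take m) (crp_ext [] t))"
    by (simp add: map_concat_hw_pmf map_bind_pmf)
  also have "\<dots> = bind_pmf (total_pmf \<nu> n) (\<lambda>t. crp_ext [] m)"
  proof (rule bind_pmf_cong)
    fix t assume "t \<in> set_pmf (total_pmf \<nu> n)"
    then have "m \<le> t" using total_pmf_ge[OF assms(1)] assms(2) le_trans by blast
    then show "map_pmf (take m) (crp_ext [] t) = crp_ext [] m" by (rule map_take_crp_ext)
  qed simp
  finally show ?thesis by simp
qed

end

section \<open>Degree counts\<close>

context crp begin

text \<open>The \<open>W\<^sub>k\<close> of the overview. Unlike the number of vertices of degree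
  exactly \<open>k\<close>, it never decreases as labels are added.\<close>

definition num_ge :: "nat \<Rightarrow> nat list \<Rightarrow> nat" where
  "num_ge k l = card {x \<in> set l. k \<le> count_list l x}"

lemma num_ge_1: "num_ge (Suc 0) l = card (set l)"
proof -
  have "{x \<in> set l. Suc 0 \<le> count_list l x} = set l"
    by (auto simp: Suc_le_eq count_list_0_iff zero_less_iff_neq_zero)
  then show ?thesis by (simp add: num_ge_def)
qed

text \<open>Only the count of \<open>i\<close> changes, and it crosses the threshold exactly when it
  becomes \<open>k\<close>. For \<open>k = 0\<close> a new label would be missed.\<close>

lemma num_ge_append1:
  assumes "1 \<le> k"
  shows "num_ge k (l @ [i]) = num_ge k l + (if Suc (count_list l i) = k then 1 else 0)"
proof (cases "Suc (count_list l i) = k")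
  case True
  have "{x \<in> set (l @ [i]). k \<le> count_list (l @ [i]) x} = insert i {x \<in> set l. k \<le> count_list l x}"
    using True by (auto simp: count_list_append)
  moreover have "i \<notin> {x \<in> set l. k \<le> count_list l x}" using True by simp
  ultimately show ?thesis using True by (simp add: num_ge_def)
next
  case False
  have "i \<in> set l" if "k \<le> Suc (count_list l i)"
    using False assms that by (metis One_nat_def count_list_0_iff le_antisym)
  then have "{x \<in> set (l @ [i]). k \<le> count_list (l @ [i]) x} = {x \<in> set l. k \<le> count_list l x}"
    using False by (auto simp: count_list_append)
  then show ?thesis using False by (simp add: num_ge_def)
qed

lemma num_ge_append: "1 \<le> k \<Longrightarrow> num_ge k l \<le> num_ge k (l @ l')"
proof (induction l' rule: rev_induct)
  case (snoc i l')
  then show ?case using num_ge_append1[of k "l @ l'" i] by simp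
qed simp

lemma card_count_eq:
  "real (card {x \<in> set l. count_list l x = k}) = real (num_ge k l) - real (num_ge (Suc k) l)"
proof -
  have "{x \<in> set l. k \<le> count_list l x} =
      {x \<in> set l. count_list l x = k} \<union> {x \<in> set l. Suc k \<le> count_list l x}" by auto
  then have "num_ge k l = card ({x \<in> set l. count_list l x = k} \<union> {x \<in> set l. Suc k \<le> count_list l x})"
    by (simp add: num_ge_def)
  also have "\<dots> = card {x \<in> set l. count_list l x = k} + num_ge (Suc k) l"
    unfolding num_ge_def by (rule card_Un_disjoint) auto
  finally show ?thesis by simp
qed

section \<open>One-step expectations\<close>

lemma integrable_crp_step: "valid l \<Longrightarrow> integrable (crp_step l) (f :: nat \<Rightarrow> real)"
  using finite_subset[OF set_crp_step] by (intro integrable_measure_pmf_finite) auto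

lemma Suc_card_notin: "valid l \<Longrightarrow> Suc (card (set l)) \<notin> set l"
  by (simp add: valid_iff)

lemma expectation_new:
  assumes "valid l" "l \<noteq> []"
  shows "measure_pmf.expectation (crp_step l) (\<lambda>i. if count_list l i = 0 then 1 else 0) =
    (\<theta> + \<alpha> * real (card (set l))) / (real (length l) + \<theta>)"
proof -
  have "(\<Sum>i\<in>set l. (if count_list l i = 0 then 1 else 0) * (real (count_list l i) - \<alpha>)) = 0"
    by (rule sum.neutral) (auto simp: count_list_0_iff)
  then show ?thesis
    using Suc_card_notin[OF assms(1)] by (simp add: expectation_crp_step[OF assms] count_list_0_iff)
qed

lemma expectation_count:
  assumes "valid l" "l \<noteq> []" "1 \<le> k"
  shows "measure_pmf.expectation (crp_step l) (\<lambda>i. if count_list l i = k then 1 else 0) =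
    (real k - \<alpha>) * (real (num_ge k l) - real (num_ge (Suc k) l)) / (real (length l) + \<theta>)"
proof -
  have "(\<Sum>i\<in>set l. (if count_list l i = k then 1 else 0) * (real (count_list l i) - \<alpha>)) =
      (\<Sum>i\<in>{x \<in> set l. count_list l x = k}. real k - \<alpha>)"
    by (rule sum.mono_neutral_cong_right) auto
  moreover have "count_list l (Suc (card (set l))) = 0"
    using Suc_card_notin[OF assms(1)] by (simp add: count_list_0_iff)
  ultimately show ?thesis
    using assms(3) by (simp add: expectation_crp_step[OF assms(1,2)] card_count_eq)
qed

text \<open>All functionals studied below change in one step by an affine function of these two
  indicators: a new vertex appears, or a vertex of degree \<open>k\<close> is chosen.\<close>

lemma expectation_affine:
  assumes "valid l" "l \<noteq> []" "1 \<le> k"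
  shows "measure_pmf.expectation (crp_step l)
      (\<lambda>i. z + x * (if count_list l i = 0 then 1 else 0) + y * (if count_list l i = k then 1 else 0)) =
    z + x * ((\<theta> + \<alpha> * real (card (set l))) / (real (length l) + \<theta>)) +
    y * ((real k - \<alpha>) * (real (num_ge k l) - real (num_ge (Suc k) l)) / (real (length l) + \<theta>))"
  by (subst Bochner_Integration.integral_add Bochner_Integration.integral_add,
      (intro integrable_crp_step assms)+)+
     (simp add: expectation_new[OF assms(1,2)] expectation_count[OF assms] del: if_distrib)

lemma crp_step_Nil: "crp_step [] = return_pmf 1"
  by (rule pmf_eqI) (auto simp: pmf_crp_step valid_Nil crp_prob_def indicator_def)

text \<open>Expectation after \<open>Suc n\<close> labels; the first label is deterministic.\<close>

definition ex :: "nat \<Rightarrow> (nat list \<Rightarrow> real) \<Rightarrow> real" where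
  "ex n f = measure_pmf.expectation (crp_ext [] (Suc n)) f"

lemma set_crp_ext_Suc:
  assumes "l \<in> set_pmf (crp_ext [] (Suc n))"
  shows "valid l" "length l = Suc n" "l \<noteq> []"
  using valid_crp_ext[OF valid_Nil assms] length_crp_ext[OF assms] by auto

lemma finite_crp_ext: "finite (set_pmf (crp_ext [] n))"
proof (induction n)
  case (Suc n)
  have "finite (set_pmf (crp_step l))" if "l \<in> set_pmf (crp_ext [] n)" for l
    using finite_subset[OF set_crp_step] valid_crp_ext[OF valid_Nil that] by auto
  with Suc show ?case by auto
qed simp

lemma integrable_crp_ext: "integrable (crp_ext [] n) (f :: nat list \<Rightarrow> real)"
  by (intro integrable_measure_pmf_finite finite_crp_ext)

lemma ex_cong: "(\<And>l. l \<in> set_pmf (crp_ext [] (Suc n)) \<Longrightarrow> f l = g l) \<Longrightarrow> ex n f = ex n g"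
  unfolding ex_def by (intro integral_cong_AE) (auto simp: AE_measure_pmf_iff)

lemma ex_mono: "(\<And>l. l \<in> set_pmf (crp_ext [] (Suc n)) \<Longrightarrow> f l \<le> g l) \<Longrightarrow> ex n f \<le> ex n g"
  unfolding ex_def by (intro integral_mono_AE integrable_crp_ext) (auto simp: AE_measure_pmf_iff)

lemma ex_add: "ex n (\<lambda>l. f l + g l) = ex n f + ex n g"
  unfolding ex_def by (intro Bochner_Integration.integral_add integrable_crp_ext)

lemma ex_cmult: "ex n (\<lambda>l. c * f l) = c * ex n f"
  by (simp add: ex_def)

lemma ex_const: "ex n (\<lambda>l. c) = c"
  by (simp add: ex_def)

lemma ex_0: "ex 0 f = f [1]"
  by (simp add: ex_def bind_return_pmf crp_step_Nil)

text \<open>Tower property; all supports are finite, so it reduces to finite sums.\<close>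

lemma ex_Suc: "ex (Suc n) f = ex n (\<lambda>l. measure_pmf.expectation (crp_step l) (\<lambda>i. f (l @ [i])))"
proof -
  have "finite (set_pmf (map_pmf (\<lambda>i. l @ [i]) (crp_step ([] @ l))))"
    if "l \<in> set_pmf (crp_ext [] (Suc n))" for l
    using finite_subset[OF set_crp_step] set_crp_ext_Suc(1)[OF that] by simp
  then have "measure_pmf.expectation (crp_ext [] (Suc (Suc n))) f =
    (\<Sum>l\<in>set_pmf (crp_ext [] (Suc n)). pmf (crp_ext [] (Suc n)) l *\<^sub>R
      measure_pmf.expectation (map_pmf (\<lambda>i. l @ [i]) (crp_step ([] @ l))) f)"
    unfolding crp_ext.simps(2)[of _ "Suc n"]
    by (intro pmf_expectation_bind finite_crp_ext) auto
  also have "\<dots> = ex n (\<lambda>l. measure_pmf.expectation (crp_step l) (\<lambda>i. f (l @ [i])))"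
  proof -
    have "ex n g = (\<Sum>l\<in>set_pmf (crp_ext [] (Suc n)). g l * pmf (crp_ext [] (Suc n)) l)" for g
      unfolding ex_def by (rule integral_measure_pmf_real[OF finite_crp_ext])
    then show ?thesis by (simp add: mult.commute del: crp_ext.simps)
  qed
  finally show ?thesis by (simp add: ex_def)
qed

end

section \<open>Moments\<close>

context crp begin

text \<open>The shift makes the probability of a new vertex exactly proportional to
  \<open>vt l\<close>.\<close>

definition vt :: "nat list \<Rightarrow> real" where
  "vt l = real (card (set l)) + \<theta> / \<alpha>"

text \<open>The sequence \<open>c\<^sub>m\<close> of the overview at time \<open>m = Suc n\<close>,
  normalised to 1 when there is a single label.\<close>

definition growth :: "nat \<Rightarrow> real" where
  "growth n = pochhammer (1 + \<theta> + \<alpha>) n / pochhammer (1 + \<theta>) n"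

lemma time_pos: "0 < real n + 1 + \<theta>"
  using \<alpha>_less_1 \<theta>_gt by linarith

lemma ratio_gt: "-1 < \<theta> / \<alpha>"
  using \<alpha>_pos \<theta>_gt by (simp add: less_divide_eq)

lemma vt_ge: "l \<noteq> [] \<Longrightarrow> 1 + \<theta> / \<alpha> \<le> vt l"
  using card_set_ge_1[of l] by (simp add: vt_def)

lemma vt_pos: "l \<noteq> [] \<Longrightarrow> 0 < vt l"
  using vt_ge[of l] ratio_gt by linarith

lemma vt_singleton: "vt [x] = 1 + \<theta> / \<alpha>"
  by (simp add: vt_def)

lemma \<alpha>_vt: "\<theta> + \<alpha> * real (card (set l)) = \<alpha> * vt l"
  using \<alpha>_pos by (simp add: vt_def field_simps)

text \<open>For \<theta> \<ge> 0 the count is at most \<open>vt l\<close>. For \<theta> < 0 it is at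
  most \<open>vt l / (1 + \<theta> / \<alpha>)\<close>, because the count is at least 1. The
  constant adds both bounds.\<close>

lemma card_le_vt:
  assumes "l \<noteq> []"
  shows "real (card (set l)) \<le> (1 + 1 / (1 + \<theta> / \<alpha>)) * vt l"
proof -
  let ?b = "\<theta> / \<alpha>"
  have pos: "0 < 1 + ?b" using ratio_gt by linarith
  have card: "1 \<le> real (card (set l))" using card_set_ge_1[OF assms] by simp
  have "real (card (set l)) \<le> vt l + vt l / (1 + ?b)"
  proof (cases "0 \<le> ?b")
    case True
    then show ?thesis using pos vt_pos[OF assms] by (simp add: vt_def)
  next
    case False
    then have "?b * real (card (set l)) \<le> ?b * 1"
      using card by (intro mult_left_mono_neg) auto
    then have "real (card (set l)) * (1 + ?b) \<le> vt l" by (simp add: vt_def algebra_simps)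
    then have "real (card (set l)) \<le> vt l / (1 + ?b)" using pos by (simp add: pos_le_divide_eq)
    then show ?thesis using vt_pos[OF assms] by linarith
  qed
  then show ?thesis by (simp add: algebra_simps)
qed

lemma growth_0: "growth 0 = 1"
  by (simp add: growth_def)

lemma growth_Suc: "growth (Suc n) = growth n * (1 + \<alpha> / (real n + 1 + \<theta>))"
proof -
  have "growth (Suc n) = growth n * ((1 + \<theta> + \<alpha> + real n) / (1 + \<theta> + real n))"
    by (simp add: growth_def pochhammer_Suc)
  also have "(1 + \<theta> + \<alpha> + real n) / (1 + \<theta> + real n) = 1 + \<alpha> / (real n + 1 + \<theta>)"
    using time_pos[of n] by (simp add: field_simps)
  finally show ?thesis .
qed

lemma growth_ge_1: "1 \<le> growth n"
proof (induction n)
  case (Suc n)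
  have "1 * 1 \<le> growth n * (1 + \<alpha> / (real n + 1 + \<theta>))"
    using time_pos[of n] \<alpha>_pos Suc by (intro mult_mono) auto
  then show ?case by (simp add: growth_Suc)
qed (simp add: growth_0)

lemma growth_pos: "0 < growth n"
  using growth_ge_1[of n] by linarith

lemma growth_le_Suc: "growth n \<le> growth (Suc n)"
  using growth_pos[of n] time_pos[of n] \<alpha>_pos by (simp add: growth_Suc)

lemma vt_append1: "vt (l @ [i]) = vt l + (if count_list l i = 0 then 1 else 0)"
  by (simp add: vt_def card_insert_if count_list_0_iff)

lemma expectation_crp_step_affine:
  assumes "l \<in> set_pmf (crp_ext [] (Suc n))" "1 \<le> k"
  shows "measure_pmf.expectation (crp_step l)
      (\<lambda>i. z + x * (if count_list l i = 0 then 1 else 0) + y * (if count_list l i = k then 1 else 0)) =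
    z + x * (\<alpha> * vt l / (real n + 1 + \<theta>)) +
    y * ((real k - \<alpha>) * (real (num_ge k l) - real (num_ge (Suc k) l)) / (real n + 1 + \<theta>))"
  using expectation_affine[OF set_crp_ext_Suc(1,3)[OF assms(1)] assms(2)]
    set_crp_ext_Suc(2)[OF assms(1)]
  by (simp only: \<alpha>_vt of_nat_Suc add.commute[of 1])

lemma expectation_crp_step_affine0:
  assumes "l \<in> set_pmf (crp_ext [] (Suc n))"
  shows "measure_pmf.expectation (crp_step l) (\<lambda>i. z + x * (if count_list l i = 0 then 1 else 0)) =
    z + x * (\<alpha> * vt l / (real n + 1 + \<theta>))"
  using expectation_crp_step_affine[OF assms order.refl, of z x 0] by simp

text \<open>\<open>vt\<close> divided by \<open>growth\<close> is a martingale.\<close>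

lemma ex_vt: "ex n vt = (1 + \<theta> / \<alpha>) * growth n"
proof (induction n)
  case 0
  show ?case by (simp add: ex_0 vt_singleton growth_0)
next
  case (Suc n)
  have "ex (Suc n) vt = ex n (\<lambda>l. (1 + \<alpha> / (real n + 1 + \<theta>)) * vt l)"
    unfolding ex_Suc
  proof (rule ex_cong)
    fix l assume l: "l \<in> set_pmf (crp_ext [] (Suc n))"
    show "measure_pmf.expectation (crp_step l) (\<lambda>i. vt (l @ [i])) = (1 + \<alpha> / (real n + 1 + \<theta>)) * vt l"
      using expectation_crp_step_affine0[OF l, of "vt l" 1] by (simp add: vt_append1 algebra_simps)
  qed
  also have "\<dots> = (1 + \<alpha> / (real n + 1 + \<theta>)) * ((1 + \<theta> / \<alpha>) * growth n)"
    by (simp only: ex_cmult Suc)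
  finally show ?case by (simp add: growth_Suc mult_ac)
qed

text \<open>Martingale increments are orthogonal, so the conditional variances of the single steps
  add up. Each has expectation at most a constant times the decrease of \<open>1 / growth\<close>,
  and the sum telescopes. The prefix \<open>take (Suc m) l\<close> is the state at the earlier
  time.\<close>

lemma ex_vt_increment:
  assumes "m \<le> n"
  shows "ex n (\<lambda>l. (vt l / growth n - vt (take (Suc m) l) / growth m)\<^sup>2)
    \<le> (1 + \<theta> / \<alpha>) * (1 / growth m - 1 / growth n)"
  using assms
proof (induction n rule: dec_induct)
  case base
  have "ex m (\<lambda>l. (vt l / growth m - vt (take (Suc m) l) / growth m)\<^sup>2) = ex m (\<lambda>l. 0)"
    by (rule ex_cong) (simp add: set_crp_ext_Suc(2))
  then show ?case by (simp add: ex_const)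
next
  case (step n)
  let ?t = "real n + 1 + \<theta>" and ?c = "growth n" and ?c' = "growth (Suc n)"
  have t: "?t > 0" by (rule time_pos)
  have c: "?c > 0" "?c' > 0" by (rule growth_pos)+
  have "ex (Suc n) (\<lambda>l. (vt l / ?c' - vt (take (Suc m) l) / growth m)\<^sup>2)
    \<le> ex n (\<lambda>l. (vt l / ?c - vt (take (Suc m) l) / growth m)\<^sup>2 + \<alpha> / (?t * ?c'\<^sup>2) * vt l)"
    unfolding ex_Suc
  proof (rule ex_mono)
    fix l assume l: "l \<in> set_pmf (crp_ext [] (Suc n))"
    define A where "A = vt l"
    define B where "B = vt (take (Suc m) l) / growth m"
    define p where "p = \<alpha> * A / ?t"
    have "take (Suc m) (l @ [i]) = take (Suc m) l" for i
      using set_crp_ext_Suc(2)[OF l] step.hyps by simp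
    then have "(vt (l @ [i]) / ?c' - vt (take (Suc m) (l @ [i])) / growth m)\<^sup>2 =
        (A / ?c' - B)\<^sup>2 + (2 * (A / ?c' - B) / ?c' + 1 / ?c'\<^sup>2) * (if count_list l i = 0 then 1 else 0)"
      for i
    proof -
      have "vt (l @ [i]) / ?c' - vt (take (Suc m) (l @ [i])) / growth m =
          (A / ?c' - B) + (if count_list l i = 0 then 1 else 0) / ?c'"
        by (simp only: vt_append1 A_def B_def \<open>take (Suc m) (l @ [i]) = take (Suc m) l\<close>)
           (simp add: add_divide_distrib)
      then show ?thesis by (simp add: power2_sum power_divide)
    qed
    then have "measure_pmf.expectation (crp_step l)
        (\<lambda>i. (vt (l @ [i]) / ?c' - vt (take (Suc m) (l @ [i])) / growth m)\<^sup>2) =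
        (A / ?c' - B)\<^sup>2 + (2 * (A / ?c' - B) / ?c' + 1 / ?c'\<^sup>2) * p"
      by (simp only: expectation_crp_step_affine0[OF l] p_def A_def)
    \<comment> \<open>Complete the square around the conditional mean; what remains is the variance
      of a Bernoulli variable with mean \<open>p\<close>, scaled by \<open>1 / ?c'\<close>.\<close>
    also have "\<dots> = (A / ?c' + p / ?c' - B)\<^sup>2 + p / ?c'\<^sup>2 - (p / ?c')\<^sup>2"
      by (simp add: power2_eq_square algebra_simps diff_divide_distrib)
    also have "A / ?c' + p / ?c' = A / ?c"
    proof -
      have "A + p = A * (1 + \<alpha> / ?t)" by (simp add: p_def algebra_simps)
      moreover have "1 + \<alpha> / ?t \<noteq> 0"
        using t \<alpha>_pos by (metis add_pos_pos divide_pos_pos less_irrefl zero_less_one)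
      ultimately show ?thesis
        unfolding growth_Suc add_divide_distrib[symmetric] by simp
    qed
    also have "(A / ?c - B)\<^sup>2 + p / ?c'\<^sup>2 - (p / ?c')\<^sup>2 \<le> (A / ?c - B)\<^sup>2 + \<alpha> / (?t * ?c'\<^sup>2) * A"
      by (simp add: p_def)
    finally show "measure_pmf.expectation (crp_step l)
        (\<lambda>i. (vt (l @ [i]) / ?c' - vt (take (Suc m) (l @ [i])) / growth m)\<^sup>2)
      \<le> (vt l / ?c - vt (take (Suc m) l) / growth m)\<^sup>2 + \<alpha> / (?t * ?c'\<^sup>2) * vt l"
      by (simp only: A_def B_def)
  qed
  also have "\<dots> \<le> (1 + \<theta> / \<alpha>) * (1 / growth m - 1 / ?c) + \<alpha> / (?t * ?c'\<^sup>2) * ((1 + \<theta> / \<alpha>) * ?c)"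
    unfolding ex_add ex_cmult ex_vt using step.IH by simp
  also have "\<dots> = (1 + \<theta> / \<alpha>) * (1 / growth m - 1 / ?c + \<alpha> * ?c / (?t * ?c'\<^sup>2))"
    by (simp add: algebra_simps)
  \<comment> \<open>The variance term is compared with the exact decrease
    \<open>1 / ?c - 1 / ?c' = \<alpha> / (?t * ?c')\<close>, using
    \<open>?c \<le> ?c'\<close>.\<close>
  also have "\<dots> \<le> (1 + \<theta> / \<alpha>) * (1 / growth m - 1 / ?c + (1 / ?c - 1 / ?c'))"
  proof -
    have "1 / ?c - 1 / ?c' = \<alpha> / (?t * ?c')"
    proof -
      have "1 / ?c - 1 / ?c' = (?c' - ?c) / (?c * ?c')" using c by (simp add: field_simps)
      also have "?c' - ?c = ?c * (\<alpha> / ?t)" by (simp add: growth_Suc algebra_simps)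
      finally show ?thesis using c by simp
    qed
    moreover have "\<alpha> * ?c / (?t * ?c'\<^sup>2) \<le> \<alpha> * ?c' / (?t * ?c'\<^sup>2)"
      using growth_le_Suc[of n] \<alpha>_pos t c by (intro divide_right_mono mult_left_mono) auto
    moreover have "\<alpha> * ?c' / (?t * ?c'\<^sup>2) = \<alpha> / (?t * ?c')"
      using c by (simp add: power2_eq_square)
    ultimately show ?thesis using ratio_gt by (intro mult_left_mono) auto
  qed
  finally show ?case by simp
qed

section \<open>Second moments of the degree fluctuations\<close>

text \<open>Index shift: \<open>tail_limit j\<close> is the limiting proportion of vertices of degree at least \<open>j + 1\<close>.\<close>

definition tail_limit :: "nat \<Rightarrow> real" where
  "tail_limit j = pochhammer (1 - \<alpha>) j / fact j"

text \<open>The \<open>U\<^sub>j\<^sub>+\<^sub>1\<close> of the overview.\<close>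

definition fluct :: "nat \<Rightarrow> nat list \<Rightarrow> real" where
  "fluct j l = real (num_ge (Suc j) l) - tail_limit j * vt l"

lemma tail_limit_Suc: "tail_limit (Suc j) * real (Suc j) = tail_limit j * (real (Suc j) - \<alpha>)"
  by (simp add: tail_limit_def pochhammer_Suc field_simps del: of_nat_Suc)
     (simp add: algebra_simps)

text \<open>The equation that singles out \<open>tail_limit\<close>: the relative gain of level
  \<open>j + 1\<close> from level \<open>j\<close> equals the growth rate \<alpha> times its size,
  so the drift of \<open>fluct\<close> has no \<open>vt\<close> term.\<close>

lemma tail_limit_balance:
  "(real (Suc j) - \<alpha>) * (tail_limit j - tail_limit (Suc j)) = \<alpha> * tail_limit (Suc j)"
  using tail_limit_Suc[of j] by (simp add: algebra_simps del: of_nat_Suc)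

text \<open>A multiple \<open>D * growth n\<close> with \<open>D \<ge> C / a\<close> is preserved by
  the recursion once \<open>a\<close> is at most the time \<open>real n + 1 + \<theta>\<close>. The
  finitely many earlier values are absorbed into \<open>D\<close>.\<close>

lemma linear_recursion_bound:
  fixes f :: "nat \<Rightarrow> real"
  assumes rec: "\<And>n. f (Suc n) \<le> f n - a * f n / (real n + 1 + \<theta>) + C * growth n / (real n + 1 + \<theta>)"
    and a: "0 < a" and C: "0 \<le> C" and nonneg: "\<And>n. 0 \<le> f n"
  shows "\<exists>D\<ge>0. \<forall>n. f n \<le> D * growth n"
proof -
  \<comment> \<open>From \<open>N\<close> on the factor \<open>1 - a / ?t\<close> is nonnegative, so
    the induction hypothesis may be multiplied by it.\<close>
  obtain N where N: "a - \<theta> \<le> real N" using real_arch_simple by blast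
  define D where "D = C / a + (\<Sum>i\<le>N. f i)"
  have sum: "0 \<le> (\<Sum>i\<le>N. f i)" using nonneg by (simp add: sum_nonneg)
  have D: "0 \<le> D" using sum a C by (simp add: D_def)
  have "f n \<le> D * growth n" for n
  proof (induction n)
    case 0
    have "f 0 \<le> (\<Sum>i\<le>N. f i)" using nonneg by (intro member_le_sum) auto
    then show ?case using a C by (simp add: growth_0 D_def add_increasing)
  next
    case (Suc n)
    show ?case
    proof (cases "Suc n \<le> N")
      case True
      have "f (Suc n) \<le> (\<Sum>i\<le>N. f i)" using nonneg True by (intro member_le_sum) auto
      also have "\<dots> \<le> D * 1" using a C by (simp add: D_def)
      also have "\<dots> \<le> D * growth (Suc n)" using growth_ge_1 D by (intro mult_left_mono) auto
      finally show ?thesis .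
    next
      case False
      let ?t = "real n + 1 + \<theta>"
      have t: "0 < ?t" by (rule time_pos)
      have at: "a \<le> ?t" using N False by linarith
      have "f (Suc n) \<le> (1 - a / ?t) * f n + C * growth n / ?t"
        using rec[of n] by (simp add: algebra_simps)
      also have "(1 - a / ?t) * f n \<le> (1 - a / ?t) * (D * growth n)"
        using Suc t at by (intro mult_left_mono) auto
      also have "(1 - a / ?t) * (D * growth n) + C * growth n / ?t =
          D * growth n - (a * D - C) * growth n / ?t"
        by (simp add: algebra_simps diff_divide_distrib)
      also have "\<dots> \<le> D * growth n"
      proof -
        have "C \<le> a * D" using a sum by (simp add: D_def distrib_left)
        then show ?thesis using growth_pos[of n] t by simp
      qed
      also have "\<dots> \<le> D * growth (Suc n)" using growth_le_Suc D by (rule mult_left_mono)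
      finally show ?thesis by simp
    qed
  qed
  with D show ?thesis by blast
qed

text \<open>The drift pulls level \<open>j + 1\<close> towards level \<open>j\<close>. Half of the
  resulting damping of the square survives the cross term, and the variance of the step is at most a
  multiple of \<open>vt l / t\<close>.\<close>

lemma ex_fluct_step:
  fixes j :: nat
  assumes l: "l \<in> set_pmf (crp_ext [] (Suc n))"
  defines "t \<equiv> real n + 1 + \<theta>" and "\<kappa> \<equiv> real (Suc j) - \<alpha>"
    and "K \<equiv> \<alpha> * (tail_limit (Suc j))\<^sup>2 + (real (Suc j) - \<alpha>) * (1 + 1 / (1 + \<theta> / \<alpha>))"
  shows "measure_pmf.expectation (crp_step l) (\<lambda>i. (fluct (Suc j) (l @ [i]))\<^sup>2) \<le>
    (fluct (Suc j) l)\<^sup>2 + (- \<kappa> / t) * (fluct (Suc j) l)\<^sup>2 + (\<kappa> / t) * (fluct j l)\<^sup>2 + (K / t) * vt l"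
proof -
  have t: "0 < t" unfolding t_def by (rule time_pos)
  have \<kappa>: "0 < \<kappa>" using \<alpha>_less_1 by (simp add: \<kappa>_def)
  define u where "u = fluct (Suc j) l"
  define u' where "u' = fluct j l"
  define w where "w = tail_limit (Suc j)"
  define d where "d = real (num_ge (Suc j) l) - real (num_ge (Suc (Suc j)) l)"
  \<comment> \<open>\<open>tail_limit_balance\<close> splits the gain into the contraction and the
    drift of \<open>tail_limit (Suc j) * vt\<close>.\<close>
  have \<kappa>d: "\<kappa> * d = \<kappa> * (u' - u) + \<alpha> * w * vt l"
  proof -
    have "d = u' - u + (tail_limit j - tail_limit (Suc j)) * vt l"
      by (simp add: d_def u_def u'_def fluct_def algebra_simps)
    then have "\<kappa> * d = \<kappa> * (u' - u) + \<kappa> * (tail_limit j - tail_limit (Suc j)) * vt l"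
      by (simp only: distrib_left mult.assoc)
    then show ?thesis by (simp only: \<kappa>_def tail_limit_balance w_def)
  qed
  \<comment> \<open>The two indicators exclude each other, so the square has no mixed term.\<close>
  have "(fluct (Suc j) (l @ [i]))\<^sup>2 = u\<^sup>2 + (w\<^sup>2 - 2 * u * w) * (if count_list l i = 0 then 1 else 0) +
      (2 * u + 1) * (if count_list l i = Suc j then 1 else 0)" for i
    unfolding fluct_def vt_append1 using num_ge_append1[of "Suc (Suc j)" l i]
    by (auto simp: u_def w_def fluct_def power2_eq_square algebra_simps)
  then have "measure_pmf.expectation (crp_step l) (\<lambda>i. (fluct (Suc j) (l @ [i]))\<^sup>2) =
      u\<^sup>2 + (w\<^sup>2 - 2 * u * w) * (\<alpha> * vt l / t) + (2 * u + 1) * (\<kappa> * d / t)"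
    by (simp only: expectation_crp_step_affine[OF l, of "Suc j"] t_def \<kappa>_def d_def)
  also have "\<dots> = u\<^sup>2 + ((w\<^sup>2 - 2 * u * w) * (\<alpha> * vt l) + 2 * u * (\<kappa> * d) + \<kappa> * d) / t"
    by (simp add: add_divide_distrib diff_divide_distrib algebra_simps)
  \<comment> \<open>After substituting \<open>\<kappa>d\<close>, the terms containing
    \<open>u * w * vt l\<close> cancel.\<close>
  also have "(w\<^sup>2 - 2 * u * w) * (\<alpha> * vt l) + 2 * u * (\<kappa> * d) =
      \<alpha> * w\<^sup>2 * vt l + \<kappa> * (2 * u * u' - 2 * u\<^sup>2)"
    unfolding \<kappa>d by (simp add: power2_eq_square algebra_simps)
  also have "u\<^sup>2 + (\<alpha> * w\<^sup>2 * vt l + \<kappa> * (2 * u * u' - 2 * u\<^sup>2) + \<kappa> * d) / t \<le>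
      u\<^sup>2 + (\<alpha> * w\<^sup>2 * vt l + \<kappa> * (u'\<^sup>2 - u\<^sup>2) + \<kappa> * ((1 + 1 / (1 + \<theta> / \<alpha>)) * vt l)) / t"
  proof -
    have "2 * u * u' - 2 * u\<^sup>2 \<le> u'\<^sup>2 - u\<^sup>2"
      using sum_squares_bound[of u u'] by simp
    moreover have "d \<le> (1 + 1 / (1 + \<theta> / \<alpha>)) * vt l"
    proof -
      have "num_ge (Suc j) l \<le> card (set l)" unfolding num_ge_def by (rule card_mono) auto
      then have "d \<le> real (card (set l))" by (simp add: d_def)
      then show ?thesis using card_le_vt[OF set_crp_ext_Suc(3)[OF l]] by linarith
    qed
    ultimately show ?thesis
      using \<kappa> t by (intro add_left_mono divide_right_mono add_mono mult_left_mono) auto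
  qed
  also have "\<dots> = u\<^sup>2 + (- \<kappa> / t) * u\<^sup>2 + (\<kappa> / t) * u'\<^sup>2 + (K / t) * vt l"
  proof -
    define C where "C = 1 + 1 / (1 + \<theta> / \<alpha>)"
    have "K = \<alpha> * w\<^sup>2 + \<kappa> * C" by (simp only: K_def w_def \<kappa>_def C_def)
    then show ?thesis
      unfolding C_def[symmetric] by (simp add: add_divide_distrib diff_divide_distrib algebra_simps)
  qed
  finally show ?thesis by (simp only: u_def u'_def)
qed

text \<open>Induction over levels: level 0 is the constant \<open>- \<theta> / \<alpha>\<close>, and
  each further level obeys a damped linear recursion whose forcing is bounded by the previous level
  and the mean of \<open>vt\<close>.\<close>

lemma ex_fluct_bound: "\<exists>C\<ge>0. \<forall>n. ex n (\<lambda>l. (fluct j l)\<^sup>2) \<le> C * growth n"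
proof (induction j)
  case 0
  have "fluct 0 l = - \<theta> / \<alpha>" for l
    by (simp add: fluct_def num_ge_1 tail_limit_def vt_def)
  then have "ex n (\<lambda>l. (fluct 0 l)\<^sup>2) \<le> (\<theta> / \<alpha>)\<^sup>2 * growth n" for n
    using mult_left_mono[OF growth_ge_1, of "(\<theta> / \<alpha>)\<^sup>2" n] by (simp add: ex_const)
  then show ?case by (intro exI[of _ "(\<theta> / \<alpha>)\<^sup>2"]) simp
next
  case (Suc j)
  then obtain C where C: "0 \<le> C" "\<And>n. ex n (\<lambda>l. (fluct j l)\<^sup>2) \<le> C * growth n" by blast
  define K where "K = \<alpha> * (tail_limit (Suc j))\<^sup>2 + (real (Suc j) - \<alpha>) * (1 + 1 / (1 + \<theta> / \<alpha>))"
  define \<kappa> where "\<kappa> = real (Suc j) - \<alpha>"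
  have \<kappa>: "0 < \<kappa>" using \<alpha>_less_1 by (simp add: \<kappa>_def)
  have b: "0 < 1 + \<theta> / \<alpha>" using ratio_gt by linarith
  have K: "0 \<le> K" using \<kappa> b \<alpha>_pos by (simp add: K_def \<kappa>_def)
  show ?case
  proof (rule linear_recursion_bound)
    fix n
    let ?t = "real n + 1 + \<theta>" and ?f = "\<lambda>n. ex n (\<lambda>l. (fluct (Suc j) l)\<^sup>2)"
    have t: "0 < ?t" by (rule time_pos)
    have "?f (Suc n) \<le> ex n (\<lambda>l. (fluct (Suc j) l)\<^sup>2 + (- \<kappa> / ?t) * (fluct (Suc j) l)\<^sup>2 +
        (\<kappa> / ?t) * (fluct j l)\<^sup>2 + (K / ?t) * vt l)"
      unfolding ex_Suc K_def \<kappa>_def by (intro ex_mono ex_fluct_step)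
    also have "\<dots> = ?f n + (- \<kappa> / ?t) * ?f n + (\<kappa> / ?t) * ex n (\<lambda>l. (fluct j l)\<^sup>2) +
        (K / ?t) * ((1 + \<theta> / \<alpha>) * growth n)"
      by (simp only: ex_add ex_cmult ex_vt)
    also have "(\<kappa> / ?t) * ex n (\<lambda>l. (fluct j l)\<^sup>2) \<le> (\<kappa> / ?t) * (C * growth n)"
      using C(2) \<kappa> t by (intro mult_left_mono) auto
    finally show "?f (Suc n) \<le> ?f n - \<kappa> * ?f n / ?t + (\<kappa> * C + K * (1 + \<theta> / \<alpha>)) * growth n / ?t"
      by (simp add: add_divide_distrib algebra_simps)
  next
    show "0 \<le> \<kappa> * C + K * (1 + \<theta> / \<alpha>)" using \<kappa> C(1) K b by simp
  next
    fix n
    have "ex n (\<lambda>l. 0) \<le> ex n (\<lambda>l. (fluct (Suc j) l)\<^sup>2)" by (rule ex_mono) simp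
    then show "0 \<le> ex n (\<lambda>l. (fluct (Suc j) l)\<^sup>2)" by (simp add: ex_const)
  qed (rule \<kappa>)
qed

section \<open>An exact negative moment of the vertex count\<close>

text \<open>Behaves like \<open>v powr (- s)\<close>, but each step multiplies its conditional expectation by a
  deterministic factor.\<close>

definition neg_weight :: "real \<Rightarrow> nat \<Rightarrow> real" where
  "neg_weight s v = pochhammer (1 + \<theta> / \<alpha> - s) (v - 1) / pochhammer (1 + \<theta> / \<alpha>) (v - 1)"

text \<open>A new vertex multiplies the weight by \<open>1 - s / vt l\<close> and appears with
  probability \<open>\<alpha> * vt l / ?t\<close>, so \<open>vt l\<close> cancels in the
  mean.\<close>

lemma ex_neg_weight:
  "ex n (\<lambda>l. neg_weight s (card (set l))) = pochhammer (1 + \<theta> - s * \<alpha>) n / pochhammer (1 + \<theta>) n"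
proof (induction n)
  case 0
  show ?case by (simp add: ex_0 neg_weight_def)
next
  case (Suc n)
  let ?t = "real n + 1 + \<theta>"
  have "ex (Suc n) (\<lambda>l. neg_weight s (card (set l))) =
      ex n (\<lambda>l. (1 - s * \<alpha> / ?t) * neg_weight s (card (set l)))"
    unfolding ex_Suc
  proof (rule ex_cong)
    fix l assume l: "l \<in> set_pmf (crp_ext [] (Suc n))"
    define v where "v = card (set l)"
    have l_ne: "l \<noteq> []" using set_crp_ext_Suc(3)[OF l] .
    obtain v' where v': "v = Suc v'" using card_set_ge_1[OF l_ne] unfolding v_def by (cases "card (set l)") auto
    have vt: "vt l = 1 + \<theta> / \<alpha> + real v'" using v' by (simp add: vt_def v_def)
    have "neg_weight s (Suc v) = neg_weight s v * ((vt l - s) / vt l)"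
      by (simp add: neg_weight_def v' pochhammer_Suc vt algebra_simps)
    also have "\<dots> = neg_weight s v - neg_weight s v * s / vt l"
      using vt_pos[OF l_ne] by (simp add: diff_divide_distrib algebra_simps)
    finally have "neg_weight s (card (set (l @ [i]))) =
        neg_weight s v + (- neg_weight s v * s / vt l) * (if count_list l i = 0 then 1 else 0)" for i
      by (simp add: card_insert_if count_list_0_iff v_def)
    then have "measure_pmf.expectation (crp_step l) (\<lambda>i. neg_weight s (card (set (l @ [i])))) =
        neg_weight s v + (- neg_weight s v * s / vt l) * (\<alpha> * vt l / ?t)"
      by (simp only: expectation_crp_step_affine0[OF l])
    also have "\<dots> = (1 - s * \<alpha> / ?t) * neg_weight s v"
      using vt_pos[OF l_ne] by (simp add: algebra_simps)
    finally show "measure_pmf.expectation (crp_step l) (\<lambda>i. neg_weight s (card (set (l @ [i])))) =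
        (1 - s * \<alpha> / ?t) * neg_weight s (card (set l))" by (simp only: v_def)
  qed
  also have "\<dots> = (1 - s * \<alpha> / ?t) * (pochhammer (1 + \<theta> - s * \<alpha>) n / pochhammer (1 + \<theta>) n)"
    by (simp only: ex_cmult Suc)
  also have "1 - s * \<alpha> / ?t = (1 + \<theta> - s * \<alpha> + real n) / (1 + \<theta> + real n)"
    using time_pos[of n] by (simp add: field_simps)
  finally show ?case by (simp add: pochhammer_Suc mult.commute)
qed

end

section \<open>Almost sure convergence from moments\<close>

text \<open>By monotone convergence the random sum has finite expectation.\<close>

lemma (in prob_space) AE_summable_of_summable_integral:
  fixes Y :: "nat \<Rightarrow> 'a \<Rightarrow> real"
  assumes int: "\<And>j. integrable M (Y j)" and nonneg: "\<And>j \<omega>. 0 \<le> Y j \<omega>"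
    and summ: "summable (\<lambda>j. \<integral>\<omega>. Y j \<omega> \<partial>M)"
  shows "AE \<omega> in M. summable (\<lambda>j. Y j \<omega>)"
proof -
  have meas[measurable]: "Y j \<in> borel_measurable M" for j using int by (rule borel_measurable_integrable)
  have "(\<integral>\<^sup>+\<omega>. (\<Sum>j. ennreal (Y j \<omega>)) \<partial>M) = (\<Sum>j. \<integral>\<^sup>+\<omega>. ennreal (Y j \<omega>) \<partial>M)"
    by (rule nn_integral_suminf) simp
  also have "\<dots> = (\<Sum>j. ennreal (\<integral>\<omega>. Y j \<omega> \<partial>M))"
    using int nonneg by (simp add: nn_integral_eq_integral)
  also have "\<dots> = ennreal (\<Sum>j. \<integral>\<omega>. Y j \<omega> \<partial>M)"
    using summ nonneg by (intro suminf_ennreal2) simp_all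
  finally have "(\<integral>\<^sup>+\<omega>. (\<Sum>j. ennreal (Y j \<omega>)) \<partial>M) \<noteq> \<infinity>" by simp
  then have "AE \<omega> in M. (\<Sum>j. ennreal (Y j \<omega>)) \<noteq> \<infinity>"
    by (intro nn_integral_PInf_AE) simp_all
  then show ?thesis
    by eventually_elim (rule summable_suminf_not_top, use nonneg in auto)
qed

text \<open>By Fatou's lemma the lower limit has finite expectation, hence is almost surely
  finite.\<close>

lemma (in prob_space) AE_not_at_top_of_bounded_integral:
  fixes Y :: "nat \<Rightarrow> 'a \<Rightarrow> real"
  assumes int: "\<And>j. integrable M (Y j)" and nonneg: "\<And>j \<omega>. 0 \<le> Y j \<omega>"
    and bound: "\<And>j. (\<integral>\<omega>. Y j \<omega> \<partial>M) \<le> C"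
  shows "AE \<omega> in M. \<not> filterlim (\<lambda>j. Y j \<omega>) at_top sequentially"
proof -
  have meas[measurable]: "Y j \<in> borel_measurable M" for j using int by (rule borel_measurable_integrable)
  have "(\<integral>\<^sup>+\<omega>. liminf (\<lambda>j. ennreal (Y j \<omega>)) \<partial>M) \<le> liminf (\<lambda>j. \<integral>\<^sup>+\<omega>. ennreal (Y j \<omega>) \<partial>M)"
    by (rule nn_integral_liminf) simp
  also have "\<dots> \<le> liminf (\<lambda>j. ennreal C)"
    using bound int nonneg
    by (intro Liminf_mono always_eventually allI) (simp add: nn_integral_eq_integral ennreal_leI)
  also have "\<dots> = ennreal C" by (simp add: Liminf_const)
  finally have "(\<integral>\<^sup>+\<omega>. liminf (\<lambda>j. ennreal (Y j \<omega>)) \<partial>M) \<noteq> \<infinity>"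
    by (auto simp: top_unique)
  then have "AE \<omega> in M. liminf (\<lambda>j. ennreal (Y j \<omega>)) \<noteq> \<infinity>"
    by (intro nn_integral_PInf_AE) simp_all
  then show ?thesis
  proof eventually_elim
    case (elim \<omega>)
    show ?case
    proof
      assume "filterlim (\<lambda>j. Y j \<omega>) at_top sequentially"
      then have "((\<lambda>j. ennreal (Y j \<omega>)) \<longlonglongrightarrow> \<infinity>)"
        by (simp add: ennreal_tendsto_top_eq_at_top)
      then have "liminf (\<lambda>j. ennreal (Y j \<omega>)) = \<infinity>"
        by (rule lim_imp_Liminf[rotated]) simp
      with elim show False by simp
    qed
  qed
qed

text \<open>For \<open>T i \<le> m \<le> T (i + 1)\<close> the ratio at \<open>m\<close> lies between \<open>W (T i) / V (T (i + 1))\<close> and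
  \<open>W (T (i + 1)) / V (T i)\<close>.\<close>

lemma ratio_tendsto_of_subsequence:
  fixes W V :: "nat \<Rightarrow> real" and T :: "nat \<Rightarrow> nat" and c :: "nat \<Rightarrow> real"
  assumes T: "strict_mono T"
    and W_mono: "\<And>m n. T 0 \<le> m \<Longrightarrow> m \<le> n \<Longrightarrow> W m \<le> W n"
    and V_mono: "\<And>m n. T 0 \<le> m \<Longrightarrow> m \<le> n \<Longrightarrow> V m \<le> V n"
    and W_nonneg: "\<And>m. T 0 \<le> m \<Longrightarrow> 0 \<le> W m" and V_pos: "\<And>m. T 0 \<le> m \<Longrightarrow> 0 < V m"
    and c_pos: "\<And>i. 0 < c i" and c: "(\<lambda>i. c (Suc i) / c i) \<longlonglongrightarrow> 1"
    and W: "(\<lambda>i. W (T i) / c i) \<longlonglongrightarrow> w * S" and V: "(\<lambda>i. V (T i) / c i) \<longlonglongrightarrow> S" and S: "0 < S"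
  shows "(\<lambda>m. W m / V m) \<longlonglongrightarrow> w"
proof -
  \<comment> \<open>Dividing by \<open>c\<close> at each index leaves the factor
    \<open>c (Suc i) / c i\<close>, which tends to 1, so shifting one index changes no
    limit.\<close>
  have "(\<lambda>i. (W (T i) / c i) / ((V (T (Suc i)) / c (Suc i)) * (c (Suc i) / c i))) \<longlonglongrightarrow> w * S / (S * 1)"
    using S by (intro tendsto_divide tendsto_mult W c LIMSEQ_Suc[OF V]) auto
  moreover have "(W (T i) / c i) / ((V (T (Suc i)) / c (Suc i)) * (c (Suc i) / c i)) =
      W (T i) / V (T (Suc i))" for i
    using c_pos[of i] c_pos[of "Suc i"] by (simp add: divide_simps)
  ultimately have "(\<lambda>i. W (T i) / V (T (Suc i))) \<longlonglongrightarrow> w * S / (S * 1)" by (simp only:)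
  then have lower: "(\<lambda>i. W (T i) / V (T (Suc i))) \<longlonglongrightarrow> w" using S by simp
  have "(\<lambda>i. (W (T (Suc i)) / c (Suc i)) * (c (Suc i) / c i) / (V (T i) / c i)) \<longlonglongrightarrow> w * S * 1 / S"
    using S by (intro tendsto_divide tendsto_mult V c LIMSEQ_Suc[OF W]) auto
  moreover have "(W (T (Suc i)) / c (Suc i)) * (c (Suc i) / c i) / (V (T i) / c i) =
      W (T (Suc i)) / V (T i)" for i
    using c_pos[of i] c_pos[of "Suc i"] by (simp add: divide_simps)
  ultimately have "(\<lambda>i. W (T (Suc i)) / V (T i)) \<longlonglongrightarrow> w * S * 1 / S" by (simp only:)
  then have upper: "(\<lambda>i. W (T (Suc i)) / V (T i)) \<longlonglongrightarrow> w" using S by simp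
  have sandwich: "\<exists>i\<ge>I. W (T i) / V (T (Suc i)) \<le> W m / V m \<and> W m / V m \<le> W (T (Suc i)) / V (T i)"
    if "T I \<le> m" for m I
  proof -
    have bound: "\<forall>i. T i \<le> m \<longrightarrow> i \<le> m"
      using strict_mono_imp_increasing[OF T] le_trans by blast
    \<comment> \<open>The last sampling time not after \<open>m\<close>; it exists because
      \<open>i \<le> T i\<close> bounds the candidates by \<open>m\<close>.\<close>
    define i where "i = (GREATEST i. T i \<le> m)"
    have i1: "T i \<le> m" unfolding i_def by (rule GreatestI_nat[of _ I m]) (use that bound in auto)
    have i2: "j \<le> i" if "T j \<le> m" for j
      unfolding i_def by (rule Greatest_le_nat[of _ j m]) (use that bound in auto)
    have i3: "m \<le> T (Suc i)" using i2[of "Suc i"] by (meson Suc_n_not_le_n nat_le_linear)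
    have T0: "T 0 \<le> T i" using T by (simp add: strict_mono_less_eq)
    have "W (T i) / V (T (Suc i)) \<le> W m / V m"
      using T0 i1 i3 by (intro frac_le W_mono V_mono V_pos W_nonneg) auto
    moreover have "W m / V m \<le> W (T (Suc i)) / V (T i)"
      using T0 i1 i3 by (intro frac_le W_mono V_mono V_pos W_nonneg) auto
    ultimately show ?thesis using i2[OF that] by blast
  qed
  show ?thesis
  proof (rule order_tendstoI)
    fix a assume "a < w"
    then obtain I where I: "\<And>i. I \<le> i \<Longrightarrow> a < W (T i) / V (T (Suc i))"
      using order_tendstoD(1)[OF lower] by (auto simp: eventually_sequentially)
    show "eventually (\<lambda>m. a < W m / V m) sequentially"
      using eventually_ge_at_top[of "T I"]
      by eventually_elim (use sandwich I less_le_trans in blast)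
  next
    fix a assume "w < a"
    then obtain I where I: "\<And>i. I \<le> i \<Longrightarrow> W (T (Suc i)) / V (T i) < a"
      using order_tendstoD(2)[OF upper] by (auto simp: eventually_sequentially)
    show "eventually (\<lambda>m. W m / V m < a) sequentially"
      using eventually_ge_at_top[of "T I"]
      by eventually_elim (use sandwich I le_less_trans in blast)
  qed
qed

lemma summable_inverse_squares: "summable (\<lambda>i. inverse ((real (Suc i))\<^sup>2))"
  using inverse_power_summable[of 2, where 'a = real]
  by (subst summable_Suc_iff[where f = "\<lambda>i. inverse ((real i)\<^sup>2)"]) simp

text \<open>The weight makes the increments absolutely summable:
  \<open>x * y \<le> x\<^sup>2 + y\<^sup>2\<close> with \<open>x = 1 / (i + 1)\<close> and
  \<open>y\<close> the increment times \<open>i + 1\<close>.\<close>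

lemma convergent_of_weighted_square_increments:
  fixes a :: "nat \<Rightarrow> real"
  assumes "summable (\<lambda>i. (real (Suc i))\<^sup>2 * (a (Suc i) - a i)\<^sup>2)"
  shows "convergent a"
proof -
  have "summable (\<lambda>i. inverse ((real (Suc i))\<^sup>2) + (real (Suc i))\<^sup>2 * (a (Suc i) - a i)\<^sup>2)"
    by (intro summable_add summable_inverse_squares assms)
  then have "summable (\<lambda>i. a (Suc i) - a i)"
  proof (rule summable_comparison_test'[where N = 0])
    fix i
    define x where "x = inverse (real (Suc i))"
    define y where "y = real (Suc i) * \<bar>a (Suc i) - a i\<bar>"
    have "x * y = \<bar>a (Suc i) - a i\<bar>" by (simp add: x_def y_def field_simps)
    moreover have "x * y \<le> x\<^sup>2 + y\<^sup>2"
      using sum_squares_bound[of x y] zero_le_power2[of x] zero_le_power2[of y] by linarith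
    moreover have "x\<^sup>2 + y\<^sup>2 = inverse ((real (Suc i))\<^sup>2) + (real (Suc i))\<^sup>2 * (a (Suc i) - a i)\<^sup>2"
      by (simp add: x_def y_def power_mult_distrib power_inverse)
    ultimately show "norm (a (Suc i) - a i) \<le>
        inverse ((real (Suc i))\<^sup>2) + (real (Suc i))\<^sup>2 * (a (Suc i) - a i)\<^sup>2" by simp
  qed
  then have "convergent (\<lambda>n. \<Sum>i<n. a (Suc i) - a i)"
    by (simp add: summable_iff_convergent)
  then have "convergent (\<lambda>n. a n - a 0)" by (simp only: sum_lessThan_telescope)
  then show ?thesis by (simp add: convergent_diff_const_right_iff)
qed

section \<open>Hollywood process\<close>

locale hollywood = crp \<alpha> \<theta> for \<alpha> \<theta> +
  fixes M :: "'a measure" and \<nu> :: "nat pmf" and X :: "nat \<Rightarrow> 'a \<Rightarrow> nat list"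
  assumes process: "hollywood_process M \<alpha> \<theta> \<nu> X" and \<nu>_pos: "0 \<notin> set_pmf \<nu>"
begin

sublocale prob_space M
  using process by (simp add: hollywood_process_def)

lemma hw_network_Suc: "hw_network X (Suc n) \<omega> = hw_network X n \<omega> @ [X (Suc n) \<omega>]"
  by (simp add: hw_network_def)

lemma length_hw_network: "length (hw_network X n \<omega>) = n"
  by (simp add: hw_network_def)

lemma measurable_hw_network[measurable]: "hw_network X n \<in> measurable M (count_space UNIV)"
proof (induction n)
  case 0
  have "hw_network X 0 = (\<lambda>\<omega>. [])" by (simp add: hw_network_def fun_eq_iff)
  then show ?case by simp
next
  case (Suc n)
  have X: "X (Suc n) \<in> measurable M (count_space UNIV)"
    using process by (simp add: hollywood_process_def)
  have "hw_network X (Suc n) -` {ys} \<inter> space M \<in> sets M" for ys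
  proof (cases ys rule: rev_cases)
    case Nil
    then have "hw_network X (Suc n) -` {ys} \<inter> space M = {}" by (auto simp: hw_network_Suc)
    then show ?thesis by simp
  next
    case (snoc h e)
    then have "hw_network X (Suc n) -` {ys} \<inter> space M =
        (hw_network X n -` {h} \<inter> space M) \<inter> (X (Suc n) -` {e} \<inter> space M)"
      by (auto simp: hw_network_Suc)
    then show ?thesis using measurable_sets[OF Suc, of "{h}"] measurable_sets[OF X, of "{e}"] by simp
  qed
  then show ?case by (subst measurable_count_space_eq2_countable) auto
qed

text \<open>Lists of lists are countable, so singletons decide; lists of the wrong length have
  probability zero on both sides.\<close>

lemma distr_hw_network: "distr M (count_space UNIV) (hw_network X n) = measure_pmf (hw_pmf \<nu> n)"
proof (rule measure_eqI_countable[of _ UNIV])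
  fix xs :: "nat list list"
  have "emeasure (distr M (count_space UNIV) (hw_network X n)) {xs} =
      ennreal (measure M {\<omega> \<in> space M. hw_network X n \<omega> = xs})"
    by (subst emeasure_distr) (auto simp: emeasure_eq_measure vimage_def Int_def conj_commute)
  also have "measure M {\<omega> \<in> space M. hw_network X n \<omega> = xs} = pmf (hw_pmf \<nu> n) xs"
  proof (cases "length xs = n")
    case True
    have "measure M {\<omega> \<in> space M. hw_network X n \<omega> = xs} =
        (\<Prod>i<n. hw_next_prob \<alpha> \<theta> \<nu> (take i xs) (xs ! i))"
      using process True unfolding hollywood_process_def hw_network_def by blast
    then show ?thesis using pmf_hw_pmf[of \<nu> xs] True by simp
  next
    case False
    then have "{\<omega> \<in> space M. hw_network X n \<omega> = xs} = {}" using length_hw_network by auto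
    moreover have "pmf (hw_pmf \<nu> n) xs = 0"
      using False hw_pmf_props[of xs \<nu> n] by (auto simp: pmf_eq_0_set_pmf)
    ultimately show ?thesis by (simp only: measure_empty)
  qed
  finally show "emeasure (distr M (count_space UNIV) (hw_network X n)) {xs} =
      emeasure (measure_pmf (hw_pmf \<nu> n)) {xs}"
    by (simp add: emeasure_pmf_single)
qed auto

lemma AE_edges_nonempty: "AE \<omega> in M. \<forall>i\<ge>1. X i \<omega> \<noteq> []"
proof -
  have "AE \<omega> in M. \<forall>e\<in>set (hw_network X n \<omega>). e \<noteq> []" for n
  proof -
    have "AE h in distr M (count_space UNIV) (hw_network X n). \<forall>e\<in>set h. e \<noteq> []"
      unfolding distr_hw_network using hw_pmf_props[of _ \<nu> n] \<nu>_pos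
      by (fastforce simp: AE_measure_pmf_iff)
    then show ?thesis by (subst (asm) AE_distr_iff) auto
  qed
  then have "AE \<omega> in M. \<forall>n. \<forall>e\<in>set (hw_network X n \<omega>). e \<noteq> []" by (simp add: AE_all_countable)
  then show ?thesis
  proof eventually_elim
    case (elim \<omega>)
    show ?case
    proof (intro allI impI)
      fix i :: nat assume "1 \<le> i"
      then have "X i \<omega> \<in> set (hw_network X i \<omega>)" by (auto simp: hw_network_def)
      then show "X i \<omega> \<noteq> []" using elim by blast
    qed
  qed
qed

text \<open>Since edges are almost surely nonempty, the first \<open>m\<close> edges contain at least \<open>m\<close> labels.\<close>

definition labels :: "nat \<Rightarrow> 'a \<Rightarrow> nat list" where
  "labels m \<omega> = take m (concat (hw_network X m \<omega>))"

lemma measurable_labels[measurable]: "labels m \<in> measurable M (count_space UNIV)"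
  unfolding labels_def[abs_def] by (rule measurable_compose[OF measurable_hw_network]) simp

lemma distr_labels: "distr M (count_space UNIV) (labels m) = measure_pmf (crp_ext [] m)"
proof -
  have "distr M (count_space UNIV) (labels m) =
      distr (distr M (count_space UNIV) (hw_network X m)) (count_space UNIV) (\<lambda>h. take m (concat h))"
    by (subst distr_distr) (auto simp: o_def labels_def[abs_def])
  also have "\<dots> = measure_pmf (crp_ext [] m)"
    unfolding distr_hw_network map_pmf_rep_eq[symmetric] map_take_concat_hw_pmf[OF \<nu>_pos order.refl] ..
  finally show ?thesis .
qed

lemma integrable_labels: "integrable M (\<lambda>\<omega>. f (labels m \<omega>) :: real)"
  using integrable_crp_ext[of m f] unfolding distr_labels[symmetric]
  by (subst (asm) integrable_distr_eq) auto

lemma integral_labels: "(\<integral>\<omega>. f (labels (Suc n) \<omega>) \<partial>M) = ex n f"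
  unfolding ex_def distr_labels[symmetric] by (subst integral_distr) auto

context
  fixes \<omega> assumes nonempty: "\<forall>i\<ge>1. X i \<omega> \<noteq> []"
begin

lemma length_concat_ge: "n \<le> length (concat (hw_network X n \<omega>))"
proof (induction n)
  case (Suc n)
  have "1 \<le> length (X (Suc n) \<omega>)" using nonempty by (simp add: Suc_le_eq)
  then have "n + 1 \<le> length (concat (hw_network X n \<omega>)) + length (X (Suc n) \<omega>)"
    using Suc by (rule add_mono[rotated])
  then show ?case by (simp add: hw_network_Suc)
qed simp

lemma concat_hw_network_prefix:
  "m \<le> n \<Longrightarrow> \<exists>r. concat (hw_network X n \<omega>) = concat (hw_network X m \<omega>) @ r"
  by (induction n rule: dec_induct) (auto simp: hw_network_Suc)

lemma labels_eq_take: "m \<le> n \<Longrightarrow> labels m \<omega> = take m (concat (hw_network X n \<omega>))"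
  using concat_hw_network_prefix[of m n] length_concat_ge[of m] by (auto simp: labels_def)

lemma take_labels: "m \<le> n \<Longrightarrow> take m (labels n \<omega>) = labels m \<omega>"
  using labels_eq_take[of m n] by (simp add: labels_def min_def)

text \<open>The network is the label process observed at a random time, its total degree.\<close>

lemma concat_hw_network_eq_labels:
  "concat (hw_network X n \<omega>) = labels (length (concat (hw_network X n \<omega>))) \<omega>"
  using concat_hw_network_prefix[OF length_concat_ge[of n]] by (auto simp: labels_def)

lemma num_ge_labels_mono:
  assumes "1 \<le> k" "m \<le> n"
  shows "num_ge k (labels m \<omega>) \<le> num_ge k (labels n \<omega>)"
proof -
  have "labels n \<omega> = labels m \<omega> @ drop m (labels n \<omega>)"
    using append_take_drop_id[of m "labels n \<omega>"] by (simp only: take_labels[OF assms(2)])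
  then show ?thesis using num_ge_append[OF assms(1)] by metis
qed

lemma labels_nonempty: "1 \<le> m \<Longrightarrow> labels m \<omega> \<noteq> []"
  using length_concat_ge[of m] by (auto simp: labels_def simp del: concat_eq_Nil_conv)

end

end

section \<open>Growth along polynomial sampling times\<close>

context crp begin

lemma growth_bounds:
  obtains L U where "0 < L" "0 < U"
    "\<And>n. L * real (Suc n) powr \<alpha> \<le> growth n" "\<And>n. growth n \<le> U * real (Suc n) powr \<alpha>"
proof -
  have pos: "0 < 1 + \<theta> + \<alpha>" "0 < 1 + \<theta>" using \<alpha>_less_1 \<theta>_gt by linarith+
  show ?thesis
  proof (rule pochhammer_ratio_bounds[OF pos])
    fix L U assume "0 < L" "0 < U"
      "\<And>n. L * real (Suc n) powr (1 + \<theta> + \<alpha> - (1 + \<theta>)) \<le> pochhammer (1 + \<theta> + \<alpha>) n / pochhammer (1 + \<theta>) n"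
      "\<And>n. pochhammer (1 + \<theta> + \<alpha>) n / pochhammer (1 + \<theta>) n \<le> U * real (Suc n) powr (1 + \<theta> + \<alpha> - (1 + \<theta>))"
    then show thesis by (intro that[of L U]) (simp_all add: growth_def)
  qed
qed

lemma growth_tendsto: "\<exists>G>0. (\<lambda>n. growth n / real (Suc n) powr \<alpha>) \<longlonglongrightarrow> G"
proof -
  have pos: "0 < 1 + \<theta> + \<alpha>" "0 < 1 + \<theta>" using \<alpha>_less_1 \<theta>_gt by linarith+
  have "(\<lambda>n. growth n * real (Suc n) powr (1 + \<theta> - (1 + \<theta> + \<alpha>))) \<longlonglongrightarrow>
      Gamma (1 + \<theta>) / Gamma (1 + \<theta> + \<alpha>)"
    unfolding growth_def by (rule pochhammer_ratio_tendsto_Suc[OF pos])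
  moreover have "growth n * real (Suc n) powr (1 + \<theta> - (1 + \<theta> + \<alpha>)) = growth n / real (Suc n) powr \<alpha>" for n
    by (simp add: powr_minus_divide)
  ultimately have "(\<lambda>n. growth n / real (Suc n) powr \<alpha>) \<longlonglongrightarrow> Gamma (1 + \<theta>) / Gamma (1 + \<theta> + \<alpha>)"
    by (simp only:)
  moreover have "0 < Gamma (1 + \<theta>) / Gamma (1 + \<theta> + \<alpha>)" using pos by (simp add: Gamma_real_pos)
  ultimately show ?thesis by blast
qed

text \<open>The index at which \<open>ex\<close> and \<open>growth\<close> refer to
  \<open>Suc i ^ p\<close> labels.\<close>

definition idx :: "nat \<Rightarrow> nat \<Rightarrow> nat" where
  "idx p i = Suc i ^ p - 1"

lemma Suc_idx: "Suc (idx p i) = Suc i ^ p"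
  by (simp add: idx_def)

lemma idx_le_Suc: "idx p i \<le> idx p (Suc i)"
  by (simp add: idx_def diff_le_mono power_mono)

text \<open>The fourth power leaves a summable \<open>1 / (i + 1)\<^sup>2\<close> after the weight
  \<open>(i + 1)\<^sup>2\<close> of the martingale increments.\<close>

lemma growth_idx_ge:
  assumes "4 \<le> real p * \<alpha>"
  obtains L where "0 < L" "\<And>i. L * real (Suc i) ^ 4 \<le> growth (idx p i)"
proof -
  obtain L where L: "0 < L" "\<And>n. L * real (Suc n) powr \<alpha> \<le> growth n"
    using growth_bounds by metis
  have "L * real (Suc i) ^ 4 \<le> growth (idx p i)" for i
  proof -
    have "real (Suc i) ^ 4 = real (Suc i) powr 4" by (simp add: powr_numeral)
    also have "\<dots> \<le> real (Suc i) powr (real p * \<alpha>)" using assms by (intro powr_mono) auto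
    also have "\<dots> = real (Suc (idx p i)) powr \<alpha>"
      by (simp add: Suc_idx powr_powr[symmetric] powr_realpow del: of_nat_Suc)
    finally have "L * real (Suc i) ^ 4 \<le> L * real (Suc (idx p i)) powr \<alpha>"
      using L(1) by (intro mult_left_mono) auto
    also have "\<dots> \<le> growth (idx p i)" by (rule L(2))
    finally show ?thesis .
  qed
  with L(1) show ?thesis using that by blast
qed

text \<open>Polynomial times are sparse enough for summability and yet dense enough for
  interpolation, because \<open>Suc (Suc i) / Suc i\<close> tends to 1.\<close>

lemma growth_idx_ratio:
  assumes "1 \<le> p"
  shows "(\<lambda>i. growth (idx p (Suc i)) / growth (idx p i)) \<longlonglongrightarrow> 1"
proof -
  obtain G where G: "0 < G" "(\<lambda>n. growth n / real (Suc n) powr \<alpha>) \<longlonglongrightarrow> G"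
    using growth_tendsto by blast
  have "i \<le> idx p i" for i
    using assms self_le_power[of "Suc i" p] by (simp add: idx_def)
  then have top: "filterlim (idx p) at_top sequentially"
    by (intro filterlim_at_top_mono[OF filterlim_ident]) auto
  define g where "g i = growth (idx p i) / real (Suc (idx p i)) powr \<alpha>" for i
  have g: "g \<longlonglongrightarrow> G" unfolding g_def[abs_def] using filterlim_compose[OF G(2) top] by simp
  have "(\<lambda>i. real (Suc (Suc i)) / real (Suc i)) \<longlonglongrightarrow> 1" by real_asymp
  then have "(\<lambda>i. ((real (Suc (Suc i)) / real (Suc i)) ^ p) powr \<alpha>) \<longlonglongrightarrow> (1 ^ p) powr \<alpha>"
    by (intro tendsto_intros) auto
  then have "(\<lambda>i. g (Suc i) / g i * ((real (Suc (Suc i)) / real (Suc i)) ^ p) powr \<alpha>) \<longlonglongrightarrow>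
      G / G * (1 ^ p) powr \<alpha>"
    using G(1) by (intro tendsto_mult tendsto_divide LIMSEQ_Suc[OF g] g) auto
  moreover have "g (Suc i) / g i * ((real (Suc (Suc i)) / real (Suc i)) ^ p) powr \<alpha> =
      growth (idx p (Suc i)) / growth (idx p i)" for i
    by (simp add: g_def Suc_idx power_divide powr_divide del: of_nat_Suc)
  ultimately have "(\<lambda>i. growth (idx p (Suc i)) / growth (idx p i)) \<longlonglongrightarrow> G / G * (1 ^ p) powr \<alpha>"
    by (simp only:)
  then show ?thesis using G(1) by simp
qed

lemma tail_limit_diff: "tail_limit j - tail_limit (Suc j) = p_alpha \<alpha> (Suc j)"
proof -
  have "(tail_limit j - tail_limit (Suc j)) * real (Suc j) = \<alpha> * tail_limit j"
    using tail_limit_Suc[of j] by (simp add: algebra_simps del: of_nat_Suc)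
  also have "\<dots> = p_alpha \<alpha> (Suc j) * real (Suc j)"
    by (simp add: tail_limit_def p_alpha_def del: of_nat_Suc)
  finally show ?thesis by (simp del: of_nat_Suc)
qed

end

section \<open>Almost sure limits\<close>

context hollywood begin

lemma AE_vt_convergent:
  assumes p: "4 \<le> real p * \<alpha>"
  shows "AE \<omega> in M. convergent (\<lambda>i. vt (labels (Suc i ^ p) \<omega>) / growth (idx p i))"
proof -
  let ?a = "\<lambda>i \<omega>. vt (labels (Suc i ^ p) \<omega>) / growth (idx p i)"
  let ?b = "\<lambda>i l. (vt l / growth (idx p (Suc i)) - vt (take (Suc i ^ p) l) / growth (idx p i))\<^sup>2"
  obtain L where L: "0 < L" "\<And>i. L * real (Suc i) ^ 4 \<le> growth (idx p i)"
    using growth_idx_ge[OF p] by blast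
  define C where "C = 1 + \<theta> / \<alpha>"
  have C: "0 < C" using ratio_gt by (simp add: C_def)
  have "AE \<omega> in M. summable (\<lambda>i. (real (Suc i))\<^sup>2 * ?b i (labels (Suc (idx p (Suc i))) \<omega>))"
  proof (rule AE_summable_of_summable_integral)
    show "summable (\<lambda>i. \<integral>\<omega>. (real (Suc i))\<^sup>2 * ?b i (labels (Suc (idx p (Suc i))) \<omega>) \<partial>M)"
    proof (rule summable_comparison_test'[where N = 0])
      show "summable (\<lambda>i. C / L * inverse ((real (Suc i))\<^sup>2))"
        by (intro summable_mult summable_inverse_squares)
    next
      fix i
      have "(\<integral>\<omega>. ?b i (labels (Suc (idx p (Suc i))) \<omega>) \<partial>M) = ex (idx p (Suc i)) (?b i)"
        by (rule integral_labels)
      also have "\<dots> \<le> C * (1 / growth (idx p i) - 1 / growth (idx p (Suc i)))"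
        using ex_vt_increment[OF idx_le_Suc, of p i] by (simp only: Suc_idx C_def)
      also have "\<dots> \<le> C * (1 / (L * real (Suc i) ^ 4))"
      proof -
        have "1 / growth (idx p i) \<le> 1 / (L * real (Suc i) ^ 4)"
          using L(1) by (intro divide_left_mono L(2) mult_pos_pos growth_pos) auto
        moreover have "0 \<le> 1 / growth (idx p (Suc i))" using growth_pos[of "idx p (Suc i)"] by simp
        ultimately show ?thesis using C by (intro mult_left_mono) linarith+
      qed
      finally have "(real (Suc i))\<^sup>2 * (\<integral>\<omega>. ?b i (labels (Suc (idx p (Suc i))) \<omega>) \<partial>M) \<le>
          (real (Suc i))\<^sup>2 * (C * (1 / (L * real (Suc i) ^ 4)))" by (intro mult_left_mono) auto
      also have "\<dots> = C / L * inverse ((real (Suc i))\<^sup>2)"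
        by (simp add: field_simps power2_eq_square power4_eq_xxxx del: of_nat_Suc)
      finally have "(\<integral>\<omega>. (real (Suc i))\<^sup>2 * ?b i (labels (Suc (idx p (Suc i))) \<omega>) \<partial>M) \<le>
          C / L * inverse ((real (Suc i))\<^sup>2)" by simp
      then show "norm (\<integral>\<omega>. (real (Suc i))\<^sup>2 * ?b i (labels (Suc (idx p (Suc i))) \<omega>) \<partial>M) \<le>
          C / L * inverse ((real (Suc i))\<^sup>2)" by (simp add: abs_of_nonneg)
    qed
    show "integrable M (\<lambda>\<omega>. (real (Suc i))\<^sup>2 * ?b i (labels (Suc (idx p (Suc i))) \<omega>))" for i
      by (rule integrable_labels)
  qed simp
  then show ?thesis using AE_edges_nonempty
  proof eventually_elim
    case (elim \<omega>)
    \<comment> \<open>Turns the prefix in the increment bound into the same trajectory at the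
      previous sampling time.\<close>
    have "take (Suc i ^ p) (labels (Suc (idx p (Suc i))) \<omega>) = labels (Suc i ^ p) \<omega>" for i
      using elim(2) by (intro take_labels) (simp_all add: Suc_idx power_mono)
    then have "summable (\<lambda>i. (real (Suc i))\<^sup>2 * (?a (Suc i) \<omega> - ?a i \<omega>)\<^sup>2)"
      using elim(1) by (simp only: Suc_idx)
    then show ?case by (rule convergent_of_weighted_square_increments)
  qed
qed

text \<open>The normalised second moment is at most \<open>C / growth (idx p i)\<close>, hence
  summable, and the terms of a convergent series tend to zero.\<close>

lemma AE_fluct_tendsto_0:
  assumes p: "4 \<le> real p * \<alpha>"
  shows "AE \<omega> in M. (\<lambda>i. fluct j (labels (Suc i ^ p) \<omega>) / growth (idx p i)) \<longlonglongrightarrow> 0"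
proof -
  obtain L where L: "0 < L" "\<And>i. L * real (Suc i) ^ 4 \<le> growth (idx p i)"
    using growth_idx_ge[OF p] by blast
  obtain C where C: "0 \<le> C" "\<And>n. ex n (\<lambda>l. (fluct j l)\<^sup>2) \<le> C * growth n"
    using ex_fluct_bound by blast
  have "AE \<omega> in M. summable (\<lambda>i. (fluct j (labels (Suc (idx p i)) \<omega>) / growth (idx p i))\<^sup>2)"
  proof (rule AE_summable_of_summable_integral)
    show "summable (\<lambda>i. \<integral>\<omega>. (fluct j (labels (Suc (idx p i)) \<omega>) / growth (idx p i))\<^sup>2 \<partial>M)"
    proof (rule summable_comparison_test'[where N = 0])
      show "summable (\<lambda>i. C / L * inverse ((real (Suc i))\<^sup>2))"
        by (intro summable_mult summable_inverse_squares)
    next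
      fix i
      let ?c = "growth (idx p i)"
      have c: "0 < ?c" by (rule growth_pos)
      have "(\<integral>\<omega>. (fluct j (labels (Suc (idx p i)) \<omega>) / ?c)\<^sup>2 \<partial>M) = ex (idx p i) (\<lambda>l. (fluct j l / ?c)\<^sup>2)"
        by (rule integral_labels)
      also have "\<dots> = ex (idx p i) (\<lambda>l. 1 / ?c\<^sup>2 * (fluct j l)\<^sup>2)" by (simp add: power_divide)
      also have "\<dots> \<le> 1 / ?c\<^sup>2 * (C * ?c)"
        unfolding ex_cmult by (intro mult_left_mono C(2)) simp
      also have "\<dots> = C * (1 / ?c)" using c by (simp add: power2_eq_square)
      also have "\<dots> \<le> C * (1 / (L * (real (Suc i))\<^sup>2))"
      proof -
        have "(real (Suc i))\<^sup>2 \<le> real (Suc i) ^ 4" by (rule power_increasing) auto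
        then have "L * (real (Suc i))\<^sup>2 \<le> ?c"
          using L(1) by (intro order.trans[OF mult_left_mono L(2)]) auto
        then show ?thesis
          using L(1) C(1) c by (intro mult_left_mono divide_left_mono mult_pos_pos) auto
      qed
      also have "\<dots> = C / L * inverse ((real (Suc i))\<^sup>2)" by (simp add: field_simps del: of_nat_Suc)
      finally show "norm (\<integral>\<omega>. (fluct j (labels (Suc (idx p i)) \<omega>) / ?c)\<^sup>2 \<partial>M) \<le>
          C / L * inverse ((real (Suc i))\<^sup>2)" by simp
    qed
    show "integrable M (\<lambda>\<omega>. (fluct j (labels (Suc (idx p i)) \<omega>) / growth (idx p i))\<^sup>2)" for i
      by (rule integrable_labels)
  qed simp
  then show ?thesis
  proof eventually_elim
    case (elim \<omega>)
    then have "(\<lambda>i. (fluct j (labels (Suc i ^ p) \<omega>) / growth (idx p i))\<^sup>2) \<longlonglongrightarrow> 0"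
      unfolding Suc_idx by (rule summable_LIMSEQ_zero)
    from tendsto_real_sqrt[OF this] have "(\<lambda>i. \<bar>fluct j (labels (Suc i ^ p) \<omega>) / growth (idx p i)\<bar>) \<longlonglongrightarrow> 0"
      by (simp only: real_sqrt_abs real_sqrt_zero)
    then show ?case by (rule tendsto_rabs_zero_cancel)
  qed
qed

text \<open>The weight \<open>Y\<close>, normalised to mean 1, would tend to infinity wherever
  \<open>vt / growth\<close> tends to zero; Fatou's lemma excludes this almost surely.\<close>

lemma AE_vt_not_tendsto_0:
  "AE \<omega> in M. \<not> (\<lambda>i. vt (labels (Suc i ^ p) \<omega>) / growth (idx p i)) \<longlonglongrightarrow> 0"
proof -
  \<comment> \<open>Halving keeps \<open>s\<close> and \<open>1 + \<theta> / \<alpha> - s\<close>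
    positive, so all Pochhammer symbols below are positive.\<close>
  define s where "s = (1 + \<theta> / \<alpha>) / 2"
  have b: "0 < 1 + \<theta> / \<alpha>" using ratio_gt by linarith
  then have s_pos: "0 < s" unfolding s_def by (rule half_gt_zero)
  moreover have "s + s = 1 + \<theta> / \<alpha>" unfolding s_def by (rule field_sum_of_halves)
  ultimately have "0 < 1 + \<theta> / \<alpha> - s" by linarith
  note s = s_pos this b
  have s\<alpha>: "s * \<alpha> = (\<alpha> + \<theta>) / 2" using \<alpha>_pos by (simp add: s_def field_simps)
  have d_pos: "0 < 1 + \<theta> - s * \<alpha>" "0 < 1 + \<theta>"
    using \<alpha>_less_1 \<theta>_gt unfolding s\<alpha> by simp_all
  define d where "d n = pochhammer (1 + \<theta> - s * \<alpha>) n / pochhammer (1 + \<theta>) n" for n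
  have d: "0 < d n" for n using d_pos by (simp add: d_def pochhammer_pos)
  obtain L1 where L1: "0 < L1" "\<And>v. L1 * real (Suc v) powr (- s) \<le> neg_weight s (Suc v)"
  proof -
    obtain L U where "0 < L" "\<And>n. L * real (Suc n) powr (1 + \<theta> / \<alpha> - s - (1 + \<theta> / \<alpha>)) \<le>
        pochhammer (1 + \<theta> / \<alpha> - s) n / pochhammer (1 + \<theta> / \<alpha>) n"
      using pochhammer_ratio_bounds[OF s(2,3)] by metis
    then show ?thesis by (intro that[of L]) (simp_all add: neg_weight_def)
  qed
  obtain U1 where U1: "0 < U1" "\<And>n. d n \<le> U1 * real (Suc n) powr (- (s * \<alpha>))"
  proof -
    obtain L U where "0 < U" "\<And>n. pochhammer (1 + \<theta> - s * \<alpha>) n / pochhammer (1 + \<theta>) n \<le>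
        U * real (Suc n) powr (1 + \<theta> - s * \<alpha> - (1 + \<theta>))"
      using pochhammer_ratio_bounds[OF d_pos] by metis
    then show ?thesis by (intro that[of U]) (simp_all add: d_def)
  qed
  obtain U2 where U2: "0 < U2" "\<And>n. growth n \<le> U2 * real (Suc n) powr \<alpha>"
    using growth_bounds by metis
  define Y where "Y i \<omega> = neg_weight s (card (set (labels (Suc (idx p i)) \<omega>))) / d (idx p i)" for i \<omega>
  have "AE \<omega> in M. \<not> filterlim (\<lambda>i. Y i \<omega>) at_top sequentially"
  proof (rule AE_not_at_top_of_bounded_integral)
    show "integrable M (Y i)" for i unfolding Y_def by (rule integrable_labels)
    show "0 \<le> Y i \<omega>" for i \<omega>
      using s d[of "idx p i"] by (simp add: Y_def neg_weight_def pochhammer_nonneg)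
    show "(\<integral>\<omega>. Y i \<omega> \<partial>M) \<le> 1" for i
    proof -
      have "(\<integral>\<omega>. Y i \<omega> \<partial>M) = (\<integral>\<omega>. neg_weight s (card (set (labels (Suc (idx p i)) \<omega>))) \<partial>M) / d (idx p i)"
        unfolding Y_def by simp
      also have "\<dots> = 1"
        using d[of "idx p i"] integral_labels[of "\<lambda>l. neg_weight s (card (set l))" "idx p i"]
        by (simp add: ex_neg_weight d_def[symmetric])
      finally show ?thesis by simp
    qed
  qed
  then show ?thesis using AE_edges_nonempty
  proof eventually_elim
    case (elim \<omega>)
    let ?l = "\<lambda>i. labels (Suc i ^ p) \<omega>"
    show ?case
    proof
      assume lim: "(\<lambda>i. vt (?l i) / growth (idx p i)) \<longlonglongrightarrow> 0"
      define K where "K = 1 + 1 / (1 + \<theta> / \<alpha>)"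
      have K: "0 < K" using s(3) by (simp add: K_def add_pos_pos)
      \<comment> \<open>Measures the count against the pure power of time, for which
        \<open>Y\<close> is bounded below by a constant times \<open>r i powr (- s)\<close>.\<close>
      define r where "r i = real (card (set (?l i))) / real (Suc (idx p i)) powr \<alpha>" for i
      have ne: "?l i \<noteq> []" for i using labels_nonempty[OF elim(2), of "Suc i ^ p"] by simp
      have card: "0 < real (card (set (?l i)))" for i using card_set_ge_1[OF ne, of i] by simp
      have r_pos: "0 < r i" for i using card by (simp add: r_def)
      have r_le: "r i \<le> K * U2 * (vt (?l i) / growth (idx p i))" for i
      proof -
        let ?q = "real (Suc (idx p i)) powr \<alpha>"
        have "r i \<le> K * vt (?l i) / ?q"
          unfolding r_def K_def by (intro divide_right_mono card_le_vt ne) simp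
        also have "1 / ?q \<le> U2 / growth (idx p i)"
          using U2(2)[of "idx p i"] growth_pos[of "idx p i"] by (simp add: field_simps)
        then have "K * vt (?l i) * (1 / ?q) \<le> K * vt (?l i) * (U2 / growth (idx p i))"
          using K vt_pos[OF ne[of i]] by (intro mult_left_mono) auto
        then have "K * vt (?l i) / ?q \<le> K * U2 * (vt (?l i) / growth (idx p i))"
          by (simp add: mult_ac)
        finally show ?thesis .
      qed
      have "(\<lambda>i. K * U2 * (vt (?l i) / growth (idx p i))) \<longlonglongrightarrow> 0"
        by (rule tendsto_mult_right_zero[OF lim])
      then have "r \<longlonglongrightarrow> 0"
        by (rule tendsto_sandwich[OF always_eventually always_eventually tendsto_const, rotated 2])
          (use r_le less_imp_le[OF r_pos] in blast)+
      then have "(\<lambda>i. r i powr s) \<longlonglongrightarrow> 0"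
        by (rule tendsto_zero_powrI[OF _ tendsto_const always_eventually s(1)])
          (use less_imp_le[OF r_pos] in blast)
      then have "filterlim (\<lambda>i. inverse (r i powr s)) at_top sequentially"
        by (rule filterlim_inverse_at_top)
          (intro always_eventually allI, simp add: less_imp_neq[OF r_pos, symmetric])
      then have r_top: "filterlim (\<lambda>i. (L1 / U1) * inverse (r i powr s)) at_top sequentially"
        using L1(1) U1(1) by (intro filterlim_tendsto_pos_mult_at_top[OF tendsto_const]) auto
      have r_le_Y: "(L1 / U1) * inverse (r i powr s) \<le> Y i \<omega>" for i
      proof -
        let ?v = "card (set (?l i))" and ?q = "real (Suc (idx p i))"
        have v: "?v = Suc (?v - 1)" using card_set_ge_1[OF ne, of i] by simp
        have "r i powr s = real ?v powr s / ?q powr (s * \<alpha>)"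
          by (simp add: r_def powr_divide powr_powr mult.commute[of \<alpha>] del: of_nat_Suc)
        then have "inverse (r i powr s) = real ?v powr (- s) / ?q powr (- (s * \<alpha>))"
          by (simp add: powr_minus divide_inverse del: of_nat_Suc)
        then have "(L1 / U1) * inverse (r i powr s) = (L1 * real ?v powr (- s)) / (U1 * ?q powr (- (s * \<alpha>)))"
          by simp
        also have "\<dots> \<le> neg_weight s ?v / d (idx p i)"
        proof (rule frac_le)
          show le: "L1 * real ?v powr (- s) \<le> neg_weight s ?v"
            using L1(2)[of "?v - 1"] by (simp only: v[symmetric])
          show "0 \<le> neg_weight s ?v"
            by (rule order.trans[OF _ le]) (use L1(1) in simp)
        qed (rule d, rule U1(2))
        finally show ?thesis by (simp add: Y_def Suc_idx)
      qed
      have "filterlim (\<lambda>i. Y i \<omega>) at_top sequentially"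
        by (rule filterlim_at_top_mono[OF r_top always_eventually]) (use r_le_Y in blast)
      with elim(1) show False by simp
    qed
  qed
qed

lemma AE_num_ge_ratio:
  "AE \<omega> in M. \<forall>j. (\<lambda>m. real (num_ge (Suc j) (labels m \<omega>)) / real (card (set (labels m \<omega>))))
     \<longlonglongrightarrow> tail_limit j"
proof -
  obtain p where p: "4 \<le> real p * \<alpha>"
    using reals_Archimedean3[OF \<alpha>_pos] less_imp_le by meson
  then have p1: "1 \<le> p" by (cases p) auto
  have "AE \<omega> in M. \<forall>j. (\<lambda>i. fluct j (labels (Suc i ^ p) \<omega>) / growth (idx p i)) \<longlonglongrightarrow> 0"
    using AE_fluct_tendsto_0[OF p] by (simp add: AE_all_countable)
  then show ?thesis using AE_vt_convergent[OF p] AE_vt_not_tendsto_0[of p] AE_edges_nonempty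
  proof eventually_elim
    case (elim \<omega>)
    let ?l = "\<lambda>m. labels m \<omega>"
    let ?T = "\<lambda>i. Suc i ^ p"
    obtain S where S: "(\<lambda>i. vt (?l (?T i)) / growth (idx p i)) \<longlonglongrightarrow> S"
      using elim(2) by (auto simp: convergent_def)
    have ne: "1 \<le> m \<Longrightarrow> ?l m \<noteq> []" for m using labels_nonempty[OF elim(4)] .
    have "0 \<le> vt (?l (?T i)) / growth (idx p i)" for i
      using vt_pos[OF ne[of "?T i"]] growth_pos[of "idx p i"] by simp
    then have "0 \<le> S" using S by (intro LIMSEQ_le_const[OF S]) auto
    \<comment> \<open>A zero limit is excluded by \<open>AE_vt_not_tendsto_0\<close>.\<close>
    then have S_pos: "0 < S" using S elim(3) by (cases "S = 0") auto
    have W: "(\<lambda>i. real (num_ge (Suc j) (?l (?T i))) / growth (idx p i)) \<longlonglongrightarrow> tail_limit j * S" for j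
    proof -
      have "(\<lambda>i. fluct j (?l (?T i)) / growth (idx p i) + tail_limit j * (vt (?l (?T i)) / growth (idx p i)))
          \<longlonglongrightarrow> 0 + tail_limit j * S"
        using elim(1) by (intro tendsto_add tendsto_mult tendsto_const S) auto
      then show ?thesis by (simp add: fluct_def diff_divide_distrib)
    qed
    show ?case
    proof
      fix j
      show "(\<lambda>m. real (num_ge (Suc j) (?l m)) / real (card (set (?l m)))) \<longlonglongrightarrow> tail_limit j"
      proof (rule ratio_tendsto_of_subsequence[where T = ?T and c = "\<lambda>i. growth (idx p i)"])
        show "strict_mono ?T" using p1 by (intro strict_monoI power_strict_mono) auto
        show "real (num_ge (Suc j) (?l m)) \<le> real (num_ge (Suc j) (?l n))" if "m \<le> n" for m n
          using num_ge_labels_mono[OF elim(4) _ that] by simp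
        show "real (card (set (?l m))) \<le> real (card (set (?l n)))" if "m \<le> n" for m n
          using num_ge_labels_mono[OF elim(4) _ that, of "Suc 0"] by (simp add: num_ge_1)
        show "0 < real (card (set (?l m)))" if "?T 0 \<le> m" for m
          using card_set_ge_1[OF ne, of m] that by simp
        \<comment> \<open>Level 0 counts all vertices, and \<open>tail_limit 0 = 1\<close>.\<close>
        show "(\<lambda>i. real (card (set (?l (?T i)))) / growth (idx p i)) \<longlonglongrightarrow> S"
          using W[of 0] by (simp add: num_ge_1 tail_limit_def)
      qed (use W growth_idx_ratio[OF p1] growth_pos S_pos in auto)
    qed
  qed
qed

text \<open>Degree exactly \<open>k\<close> is the difference of two consecutive tails; the limit
  along all label times passes to the observation times, which tend to infinity.\<close>

lemma AE_degree_proportion: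
  assumes "1 \<le> k"
  shows "AE \<omega> in M. (\<lambda>n. real (net_N k (hw_network X n \<omega>)) / real (net_v (hw_network X n \<omega>)))
    \<longlonglongrightarrow> p_alpha \<alpha> k"
  using AE_num_ge_ratio AE_edges_nonempty
proof eventually_elim
  case (elim \<omega>)
  obtain j where k: "k = Suc j" using assms by (cases k) auto
  define t where "t n = length (concat (hw_network X n \<omega>))" for n
  let ?l = "\<lambda>m. labels m \<omega>"
  have "(\<lambda>m. real (num_ge k (?l m)) / real (card (set (?l m))) -
      real (num_ge (Suc k) (?l m)) / real (card (set (?l m)))) \<longlonglongrightarrow> tail_limit j - tail_limit (Suc j)"
    unfolding k using elim(1) by (intro tendsto_diff) auto
  then have lim: "(\<lambda>m. real (card {x \<in> set (?l m). count_list (?l m) x = k}) / real (card (set (?l m))))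
      \<longlonglongrightarrow> p_alpha \<alpha> k"
    by (simp add: card_count_eq diff_divide_distrib tail_limit_diff k)
  have "filterlim t at_top sequentially"
    using length_concat_ge[OF elim(2)]
    by (intro filterlim_at_top_mono[OF filterlim_ident]) (auto simp: t_def)
  from filterlim_compose[OF lim this]
  show ?case
    using concat_hw_network_eq_labels[OF elim(2)] by (simp add: net_N_def net_v_def t_def)
qed

end

theorem theorem5p2:
  fixes M :: "'a measure" and \<alpha> \<theta> :: real and \<nu> :: "nat pmf"
    and X :: "nat \<Rightarrow> 'a \<Rightarrow> nat list"
  assumes "0 \<notin> set_pmf \<nu>"
    and "0 < \<alpha>" and "\<alpha> < 1" and "\<theta> > - \<alpha>"
    and "hollywood_process M \<alpha> \<theta> \<nu> X"
  shows "(\<forall>k\<ge>1. AE \<omega> in M.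
            (\<lambda>n. real (net_N k (hw_network X n \<omega>)) / real (net_v (hw_network X n \<omega>)))
              \<longlonglongrightarrow> p_alpha \<alpha> k)
       \<and> p_alpha \<alpha> \<sim>[at_top] (\<lambda>k. \<alpha> * real k powr (- (\<alpha> + 1)) / Gamma (1 - \<alpha>))
       \<and> power_law (p_alpha \<alpha>) (1 + \<alpha>)"
proof -
  interpret hollywood \<alpha> \<theta> M \<nu> X
    using assms by unfold_locales auto
  show ?thesis
    using AE_degree_proportion p_alpha_asymp[OF assms(2,3)] p_alpha_power_law[OF assms(2,3)] by blast
qed

end
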